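(* Let $\pi_w=\{\mu_{k,w_k}\}_{k=0}^{N-1}$ be a design policy parameterized by $w=\{w_k\}_{k=0}^{N-1}$, let $\psi_w$ be the stopping policy induced by $\pi_w$ through the value-based stopping rule, and let $\tau_w$ be the induced stopping time. Assume the following regularity conditions: 1. the design policy is differentiable in $w$; 2. the continuation value $Q_k^{\pi_w,\psi_w}(s_k,\xi_k)$ is differentiable in its current-design argument $\xi_k$; 3. the event that a trajectory lies exactly on the stopping boundary has probability zero under the trajectory distribution induced by $(\pi_w,\psi_w)$; 4. differentiation may be interchanged with the relevant expectations. Let $\nabla_{\xi_k}Q_k^{\pi_w,\psi_w}(s_k,\xi_k)$ denote the partial derivative of the continuation value with respect to the current design argument, holding the future policies $(\pi_w,\psi_w)$ fixed. Then the gradient of the expected utility with respect to $w$ is $$\nabla_w U(w)=\sum_{k=0}^{N-1}\mathbb{E}_{s_k|\pi_w,\psi_w,s_0}\left[\mathbf{1}_{k<\tau_w}\,\nabla_w\mu_{k,w_k}(s_k)\cdot\nabla_{\xi_k}Q_k^{\pi_w,\psi_w}(s_k,\xi_k)\big|_{\xi_k=\mu_{k,w_k}(s_k)}\right].$$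
   Context: **Bayesian model.** At most $N$ experiments, indexed $k=0,\ldots,N-1$, are performed. $\Theta\in\mathbb{R}^p$ is an unknown random parameter with prior density $p(\theta|I_0)$. Experiment $k$ has a design $\xi_k\in\Xi_k\subseteq\mathbb{R}^d$ and an observation $Y_k\in\mathbb{R}^n$; the history before experiment $k$ is $I_k=\{\xi_0,y_0,\ldots,\xi_{k-1},y_{k-1}\}$, $I_0=\emptyset$. Observations satisfy $Y_k=G_k(\Theta,\xi_k;I_k)+\mathcal{E}_k$, where $G_k$ is a given forward map and $\mathcal{E}_k\in\mathbb{R}^n$ is noise with known density $p_\epsilon$, conditionally independent across stages given $(\theta,\xi_k,I_k)$. This gives the likelihood $p(y_k|\theta,\xi_k,I_k)$, the marginal likelihood (predictive density) $p(y_k|\xi_k,I_k)=\int p(y_k|\theta,\xi_k,I_k)\,p(\theta|I_k)\,d\theta$, and the updated density $p(\theta|I_{k+1})=p(y_k|\theta,\xi_k,I_k)p(\theta|I_k)/p(y_k|\xi_k,I_k)$. $p_{\Theta|I_k}$ denotes the distribution of $\Theta$ with density $p(\theta|I_k)$, and $D_{\mathrm{KL}}$ is Kullback–Leibler divergence. **States and policies.** The state $s_k\in\mathcal{S}$ at stage $k$ contains the current belief about $\Theta$ and all deterministic information needed for future decisions and for the rewards (for instance $s_k=I_k$); $s_0$ is a fixed initial state. There is also a terminal state $T$, reached once experimentation stops. A design policy is $\pi=\{\mu_k:\mathcal{S}\to\Xi_k\}_{k=0}^{N-1}$; a stopping policy is $\psi=\{\varphi_k:\mathcal{S}\to\{0,1\}\}_{k=0}^{N-1}$,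 with $\varphi_k(s_k)=1$ meaning stop and $0$ meaning continue. Under $(\pi,\psi)$, if $s_k\ne T$ and $\varphi_k(s_k)=0$, then $\xi_k=\mu_k(s_k)$, $Y_k$ is drawn from the predictive distribution given $(s_k,\xi_k)$, and $s_{k+1}=\mathcal{F}_k(s_k,\xi_k,Y_k)$, where $\mathcal{F}_k$ encodes the Bayesian update and any deterministic evolution; otherwise $s_{k+1}=T$. If no stopping occurs before stage $N$, the process terminates at $s_N$. **Rewards.** $c_k(\xi_k)\le 0$ is the cost of experiment $k$. The rewards $r_k$ (stage) and $r_T$ (terminal) are given by either of two formulations: - Terminal formulation: $r_k=0$, and $r_T(s_k)=D_{\mathrm{KL}}(p_{\Theta|I_k}\,||\,p_{\Theta|I_0})+\sum_{i=0}^{k-1}c_i(\xi_i)$ if $s_k\ne T$ and ($k<N$ and $\varphi_k(s_k)=1$, or $k=N$); $r_T(s_k)=0$ otherwise. - Incremental formulation: $r_k(s_k,\xi_k,y_k)=D_{\mathrm{KL}}(p_{\Theta|I_{k+1}}\,||\,p_{\Theta|I_k})+c_k(\xi_k)$ if $s_k\ne T$ and $\varphi_k(s_k)=0$, and $0$ otherwise; $r_T=0$. $r_T^S(s_k)$ denotes the terminal reward that would be collected if stopping were selected at $s_k$ ($D_{\mathrm{KL}}(p_{\Theta|I_k}||p_{\Theta|I_0})+\sum_{i<k}c_i(\xi_i)$ in the terminal formulation, $0$ in the incremental one). $r_k^C(s_k,\xi_k,y_k)$ denotes the stage reward collected if continuation were selected, $\xi_k$ performed and $y_k$ observed ($0$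 in the terminal formulation, $D_{\mathrm{KL}}(p_{\Theta|I_{k+1}}||p_{\Theta|I_k})+c_k(\xi_k)$ in the incremental one). **Value functions.** For nonterminal states, $V_N^{\pi,\psi}(s_N)=r_T(s_N)$ and, for $k<N$, $V_k^{\pi,\psi}(s_k)=r_T^S(s_k)$ if $\varphi_k(s_k)=1$ and $V_k^{\pi,\psi}(s_k)=Q_k^{\pi,\psi}(s_k,\mu_k(s_k))$ if $\varphi_k(s_k)=0$, where the continuation value is $$Q_k^{\pi,\psi}(s_k,\xi_k)=\mathbb{E}_{Y_k|s_k,\xi_k}\big[r_k^C(s_k,\xi_k,Y_k)+V_{k+1}^{\pi,\psi}(\mathcal{F}_k(s_k,\xi_k,Y_k))\big].$$ **Parameterized policies.** Each design map $\mu_k$ is parameterized by a vector $w_k$, written $\mu_{k,w_k}$; $w=\{w_k\}_{k=0}^{N-1}$ collects all parameters (only the block $w_k$ enters the stage-$k$ map), and $\pi_w=\{\mu_{k,w_k}\}_{k=0}^{N-1}$. The induced stopping policy $\psi_w=\{\varphi_{k,w}\}_{k=0}^{N-1}$ is $\varphi_{k,w}(s_k)=\mathbf{1}_{s_k\in\mathcal{T}_{k,w}}$ with $$\mathcal{T}_{k,w}=\left\{s_k\in\mathcal{S}:\ r_T^S(s_k)\ge Q_k^{\pi_w,\psi_w}(s_k,\mu_{k,w_k}(s_k))\right\}$$ (determined recursively backward in $k$, since $Q_k^{\pi_w,\psi_w}$ depends only on the stopping rules at later stages). The stopping boundary at stage $k$ is the set of states where equality $r_T^S(s_k)=Q_k^{\pi_w,\psi_w}(s_k,\mu_{k,w_k}(s_k))$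 holds. The stopping time is $\tau_w=\inf\{k\in\{0,\ldots,N-1\}:\varphi_{k,w}(s_k)=1\}\wedge N$ (with $\inf\emptyset=\infty$). The expected utility is $$U(w)=\mathbb{E}_{Y_{0:N-1}|\pi_w,\psi_w,s_0}\Big[\sum_{k=0}^{N-1}\{r_k(s_k,\mu_{k,w_k}(s_k),Y_k)+r_T(s_k)\}+r_T(s_N)\Big].$$ $\mathbb{E}_{s_k|\pi_w,\psi_w,s_0}$ is expectation over the distribution of the stage-$k$ state under $(\pi_w,\psi_w)$ started at $s_0$; the integrand is $0$ when $k\ge\tau_w$. The product $\nabla_w\mu_{k,w_k}(s_k)\cdot\nabla_{\xi_k}Q$ is the transposed Jacobian of $w\mapsto\mu_{k,w_k}(s_k)\in\mathbb{R}^d$ applied to the vector $\nabla_{\xi_k}Q\in\mathbb{R}^d$. In condition 4, the relevant expectations are those over $Y_k$ defining the continuation values $Q_k^{\pi_w,\psi_w}(s_k,\xi_k)$: for fixed $\xi_k$, the $w$-derivative exists and may be taken inside the expectation. Measurability and well-definedness of all expectations are understood. *)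

theory Defs
  imports "HOL-Probability.Probability"
begin

datatype formulation = Terminal | Incremental

text \<open>
  The state is abstract. Everything that depends on the history \<open>I\<^sub>k\<close> (belief, forward map and, in the
  terminal formulation, the cost already spent) is a function of the state; \<open>s\<^sub>k = I\<^sub>k\<close> is one instance.
\<close>

record ('s, 'p, 'd, 'n) oed =
  horizon :: nat
  designs :: "nat \<Rightarrow> (real ^ 'd) set"
  states :: "'s measure"
  init :: 's
  prior :: "real ^ 'p \<Rightarrow> real"
  noise :: "real ^ 'n \<Rightarrow> real"
  forward :: "nat \<Rightarrow> real ^ 'p \<Rightarrow> real ^ 'd \<Rightarrow> 's \<Rightarrow> real ^ 'n"
  evolve :: "nat \<Rightarrow> 's \<Rightarrow> real ^ 'd \<Rightarrow> real ^ 'n \<Rightarrow> 's"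
  belief :: "'s \<Rightarrow> real ^ 'p \<Rightarrow> real"
  cost :: "nat \<Rightarrow> real ^ 'd \<Rightarrow> real"
  spent :: "'s \<Rightarrow> real"
  rewards :: formulation

type_synonym ('s, 'd) design_policy = "nat \<Rightarrow> 's \<Rightarrow> real ^ 'd"
type_synonym 's stopping_policy = "nat \<Rightarrow> 's \<Rightarrow> bool"

definition likelihood ::
    "('s, 'p::finite, 'd::finite, 'n::finite) oed \<Rightarrow> nat \<Rightarrow> real ^ 'n \<Rightarrow> real ^ 'p \<Rightarrow> real ^ 'd \<Rightarrow> 's \<Rightarrow> real"
  where "likelihood M k y \<theta> \<xi> s = noise M (y - forward M k \<theta> \<xi> s)"

definition evidence ::
    "('s, 'p::finite, 'd::finite, 'n::finite) oed \<Rightarrow> nat \<Rightarrow> real ^ 'n \<Rightarrow> real ^ 'd \<Rightarrow> 's \<Rightarrow> real"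
  where "evidence M k y \<xi> s = (LINT \<theta>|lborel. likelihood M k y \<theta> \<xi> s * belief M s \<theta>)"

definition posterior ::
    "('s, 'p::finite, 'd::finite, 'n::finite) oed \<Rightarrow> nat \<Rightarrow> 's \<Rightarrow> real ^ 'd \<Rightarrow> real ^ 'n \<Rightarrow> real ^ 'p \<Rightarrow> real"
  where "posterior M k s \<xi> y \<theta> = likelihood M k y \<theta> \<xi> s * belief M s \<theta> / evidence M k y \<xi> s"

definition predictive ::
    "('s, 'p::finite, 'd::finite, 'n::finite) oed \<Rightarrow> nat \<Rightarrow> 's \<Rightarrow> real ^ 'd \<Rightarrow> (real ^ 'n) measure"
  where "predictive M k s \<xi> = density lborel (\<lambda>y. ennreal (evidence M k y \<xi> s))"

text \<open>\<open>KL_divergence b P Q\<close> of the library is the divergence of its second argument from its first.\<close>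

definition KL :: "(real ^ 'p::finite \<Rightarrow> real) \<Rightarrow> (real ^ 'p \<Rightarrow> real) \<Rightarrow> real"
  where "KL p q = KL_divergence (exp 1) (density lborel (\<lambda>\<theta>. ennreal (q \<theta>)))
                                        (density lborel (\<lambda>\<theta>. ennreal (p \<theta>)))"

definition stop_reward :: "('s, 'p::finite, 'd::finite, 'n::finite) oed \<Rightarrow> 's \<Rightarrow> real"
  where "stop_reward M s =
    (case rewards M of Terminal \<Rightarrow> KL (belief M s) (prior M) + spent M s | Incremental \<Rightarrow> 0)"

definition cont_reward ::
    "('s, 'p::finite, 'd::finite, 'n::finite) oed \<Rightarrow> nat \<Rightarrow> 's \<Rightarrow> real ^ 'd \<Rightarrow> real ^ 'n \<Rightarrow> real"
  where "cont_reward M k s \<xi> y =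
    (case rewards M of Terminal \<Rightarrow> 0
     | Incremental \<Rightarrow> KL (belief M (evolve M k s \<xi> y)) (belief M s) + cost M k \<xi>)"

text \<open>
  The Bayes update is only required where the evidence is positive (a set of predictive probability
  one): elsewhere the quotient is not a density.
\<close>

definition oed_model :: "('s, 'p::finite, 'd::finite, 'n::finite) oed \<Rightarrow> bool"
  where "oed_model M \<longleftrightarrow>
    init M \<in> space (states M) \<and>
    belief M (init M) = prior M \<and>
    noise M \<in> borel_measurable borel \<and> (\<forall>e. 0 \<le> noise M e) \<and>
    prob_space (density lborel (\<lambda>e. ennreal (noise M e))) \<and>
    (\<lambda>(s, \<theta>). belief M s \<theta>) \<in> borel_measurable (states M \<Otimes>\<^sub>M borel) \<and>
    (\<forall>s \<in> space (states M). (\<forall>\<theta>. 0 \<le> belief M s \<theta>) \<and>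
       prob_space (density lborel (\<lambda>\<theta>. ennreal (belief M s \<theta>)))) \<and>
    stop_reward M \<in> borel_measurable (states M) \<and>
    (\<forall>k < horizon M.
       (\<lambda>(\<theta>, \<xi>, s). forward M k \<theta> \<xi> s)
         \<in> borel_measurable (borel \<Otimes>\<^sub>M restrict_space borel (designs M k) \<Otimes>\<^sub>M states M) \<and>
       (\<lambda>(s, \<xi>, y). evolve M k s \<xi> y)
         \<in> states M \<Otimes>\<^sub>M restrict_space borel (designs M k) \<Otimes>\<^sub>M borel \<rightarrow>\<^sub>M states M \<and>
       (\<lambda>(s, \<xi>, y). cont_reward M k s \<xi> y)
         \<in> borel_measurable (states M \<Otimes>\<^sub>M restrict_space borel (designs M k) \<Otimes>\<^sub>M borel) \<and>
       (\<forall>\<xi> \<in> designs M k. cost M k \<xi> \<le> 0) \<and>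
       (\<forall>s \<in> space (states M). \<forall>\<xi> \<in> designs M k. \<forall>y. 0 < evidence M k y \<xi> s \<longrightarrow>
          belief M (evolve M k s \<xi> y) = posterior M k s \<xi> y)) \<and>
    (rewards M = Terminal \<longrightarrow>
       spent M (init M) = 0 \<and>
       (\<forall>k < horizon M. \<forall>s \<in> space (states M). \<forall>\<xi> \<in> designs M k. \<forall>y.
          spent M (evolve M k s \<xi> y) = spent M s + cost M k \<xi>))"

text \<open>The terminal state \<open>T\<close> is \<open>None\<close>.\<close>

definition terminal_reward ::
    "('s, 'p::finite, 'd::finite, 'n::finite) oed \<Rightarrow> 's stopping_policy \<Rightarrow> nat \<Rightarrow> 's option \<Rightarrow> real"
  where "terminal_reward M \<phi> k x =
    (case x of None \<Rightarrow> 0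
     | Some s \<Rightarrow> if (k < horizon M \<and> \<phi> k s) \<or> k = horizon M then stop_reward M s else 0)"

definition stage_reward ::
    "('s, 'p::finite, 'd::finite, 'n::finite) oed \<Rightarrow> ('s, 'd) design_policy \<Rightarrow> 's stopping_policy \<Rightarrow>
     nat \<Rightarrow> 's option \<Rightarrow> real ^ 'n \<Rightarrow> real"
  where "stage_reward M \<pi> \<phi> k x y =
    (case x of None \<Rightarrow> 0 | Some s \<Rightarrow> if \<phi> k s then 0 else cont_reward M k s (\<pi> k s) y)"

primrec state_at ::
    "('s, 'p::finite, 'd::finite, 'n::finite) oed \<Rightarrow> ('s, 'd) design_policy \<Rightarrow> 's stopping_policy \<Rightarrow>
     nat \<Rightarrow> (nat \<Rightarrow> real ^ 'n) \<Rightarrow> 's option"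
  where
    "state_at M \<pi> \<phi> 0 y = Some (init M)"
  | "state_at M \<pi> \<phi> (Suc k) y =
       (case state_at M \<pi> \<phi> k y of None \<Rightarrow> None
        | Some s \<Rightarrow> if \<phi> k s then None else Some (evolve M k s (\<pi> k s) (y k)))"

text \<open>
  Once stopped, no observation is made; the coordinate \<open>y k\<close> is then filled with the dummy value \<open>0\<close>,
  on which neither states nor rewards depend.
\<close>

definition obs_kernel ::
    "('s, 'p::finite, 'd::finite, 'n::finite) oed \<Rightarrow> ('s, 'd) design_policy \<Rightarrow> 's stopping_policy \<Rightarrow>
     nat \<Rightarrow> (nat \<Rightarrow> real ^ 'n) \<Rightarrow> (real ^ 'n) measure"
  where "obs_kernel M \<pi> \<phi> k y =
    (case state_at M \<pi> \<phi> k y of None \<Rightarrow> return borel 0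
     | Some s \<Rightarrow> if \<phi> k s then return borel 0 else predictive M k s (\<pi> k s))"

text \<open>\<open>obs_law M \<pi> \<phi> k\<close> is the joint law of \<open>Y\<^sub>0, \<dots>, Y\<^sub>k\<^sub>-\<^sub>1\<close>.\<close>

primrec obs_law ::
    "('s, 'p::finite, 'd::finite, 'n::finite) oed \<Rightarrow> ('s, 'd) design_policy \<Rightarrow> 's stopping_policy \<Rightarrow>
     nat \<Rightarrow> (nat \<Rightarrow> real ^ 'n) measure"
  where
    "obs_law M \<pi> \<phi> 0 = return (PiM {..<0} (\<lambda>_. borel)) (\<lambda>_. undefined)"
  | "obs_law M \<pi> \<phi> (Suc k) =
       obs_law M \<pi> \<phi> k \<bind>
         (\<lambda>y. distr (obs_kernel M \<pi> \<phi> k y) (PiM {..<Suc k} (\<lambda>_. borel)) (\<lambda>z. y(k := z)))"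

abbreviation trajectory_law ::
    "('s, 'p::finite, 'd::finite, 'n::finite) oed \<Rightarrow> ('s, 'd) design_policy \<Rightarrow> 's stopping_policy \<Rightarrow>
     (nat \<Rightarrow> real ^ 'n) measure"
  where "trajectory_law M \<pi> \<phi> \<equiv> obs_law M \<pi> \<phi> (horizon M)"

definition stopping_time ::
    "('s, 'p::finite, 'd::finite, 'n::finite) oed \<Rightarrow> ('s, 'd) design_policy \<Rightarrow> 's stopping_policy \<Rightarrow>
     (nat \<Rightarrow> real ^ 'n) \<Rightarrow> nat"
  where "stopping_time M \<pi> \<phi> y =
    Min (insert (horizon M)
          {k. k < horizon M \<and> (\<exists>s. state_at M \<pi> \<phi> k y = Some s \<and> \<phi> k s)})"

definition total_reward ::
    "('s, 'p::finite, 'd::finite, 'n::finite) oed \<Rightarrow> ('s, 'd) design_policy \<Rightarrow> 's stopping_policy \<Rightarrow>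
     (nat \<Rightarrow> real ^ 'n) \<Rightarrow> real"
  where "total_reward M \<pi> \<phi> y =
    (\<Sum>k<horizon M. stage_reward M \<pi> \<phi> k (state_at M \<pi> \<phi> k y) (y k)
                    + terminal_reward M \<phi> k (state_at M \<pi> \<phi> k y))
    + terminal_reward M \<phi> (horizon M) (state_at M \<pi> \<phi> (horizon M) y)"

definition expected_utility ::
    "('s, 'p::finite, 'd::finite, 'n::finite) oed \<Rightarrow> ('s, 'd) design_policy \<Rightarrow> 's stopping_policy \<Rightarrow> real"
  where "expected_utility M \<pi> \<phi> = (LINT y|trajectory_law M \<pi> \<phi>. total_reward M \<pi> \<phi> y)"

definition backup ::
    "('s, 'p::finite, 'd::finite, 'n::finite) oed \<Rightarrow> nat \<Rightarrow> ('s \<Rightarrow> real) \<Rightarrow> 's \<Rightarrow> real ^ 'd \<Rightarrow> real"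
  where "backup M k v s \<xi> =
    (LINT y|predictive M k s \<xi>. cont_reward M k s \<xi> y + v (evolve M k s \<xi> y))"

function stage_value ::
    "('s, 'p::finite, 'd::finite, 'n::finite) oed \<Rightarrow> ('s, 'd) design_policy \<Rightarrow> 's stopping_policy \<Rightarrow>
     nat \<Rightarrow> 's \<Rightarrow> real"
  where "stage_value M \<pi> \<phi> k s =
    (if k < horizon M then
       (if \<phi> k s then stop_reward M s
        else backup M k (stage_value M \<pi> \<phi> (Suc k)) s (\<pi> k s))
     else terminal_reward M \<phi> (horizon M) (Some s))"
  by pat_completeness auto
termination
  by (relation "Wellfounded.measure (\<lambda>(M, \<pi>, \<phi>, k, s). horizon M - k)") auto

declare stage_value.simps [simp del]

definition cont_value ::
    "('s, 'p::finite, 'd::finite, 'n::finite) oed \<Rightarrow> ('s, 'd) design_policy \<Rightarrow> 's stopping_policy \<Rightarrow>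
     nat \<Rightarrow> 's \<Rightarrow> real ^ 'd \<Rightarrow> real"
  where "cont_value M \<pi> \<phi> k = backup M k (stage_value M \<pi> \<phi> (Suc k))"

text \<open>
  \<open>stop_from M \<pi> j\<close> fixes the stopping rule at the last \<open>j\<close> stages, working backward; the stages not
  yet reached are irrelevant. The defining equation of the induced policy is \<open>induced_stop_iff\<close>.
\<close>

primrec stop_from ::
    "('s, 'p::finite, 'd::finite, 'n::finite) oed \<Rightarrow> ('s, 'd) design_policy \<Rightarrow> nat \<Rightarrow> 's stopping_policy"
  where
    "stop_from M \<pi> 0 = (\<lambda>k s. False)"
  | "stop_from M \<pi> (Suc j) =
       (let \<phi> = stop_from M \<pi> j; k = horizon M - Suc j
        in \<phi>(k := (\<lambda>s. stop_reward M s \<ge> cont_value M \<pi> \<phi> k s (\<pi> k s))))"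

definition induced_stop ::
    "('s, 'p::finite, 'd::finite, 'n::finite) oed \<Rightarrow> ('s, 'd) design_policy \<Rightarrow> 's stopping_policy"
  where "induced_stop M \<pi> = stop_from M \<pi> (horizon M)"

lemma stage_value_cong:
  assumes "\<And>l s. k \<le> l \<Longrightarrow> l < horizon M \<Longrightarrow> \<phi> l s = \<phi>' l s"
  shows "stage_value M \<pi> \<phi> k = stage_value M \<pi> \<phi>' k"
  using assms
proof (induction "horizon M - k" arbitrary: k)
  case 0
  then show ?case
    by (intro ext) (simp add: stage_value.simps[of M \<pi> _ k] terminal_reward_def)
next
  case (Suc n)
  have next_eq: "stage_value M \<pi> \<phi> (Suc k) = stage_value M \<pi> \<phi>' (Suc k)"
    using Suc.hyps(2) by (intro Suc.hyps(1) Suc.prems) auto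
  have "k < horizon M"
    using Suc.hyps(2) by linarith
  then have "\<phi> k s = \<phi>' k s" for s
    by (intro Suc.prems) auto
  then show ?case
    using \<open>k < horizon M\<close>
    by (intro ext) (simp add: stage_value.simps[of M \<pi> _ k] next_eq)
qed

lemma stop_from_stable:
  assumes "horizon M - j \<le> l" and "l < horizon M" and "j \<le> j'" and "j' \<le> horizon M"
  shows "stop_from M \<pi> j' l = stop_from M \<pi> j l"
  using assms(3,4)
proof (induction j' rule: dec_induct)
  case (step i)
  then have "l \<noteq> horizon M - Suc i"
    using assms(1,2) by linarith
  then show ?case
    using step by (simp add: Let_def)
qed simp

lemma induced_stop_iff:
  assumes "k < horizon M"
  shows "induced_stop M \<pi> k s \<longleftrightarrow>
         stop_reward M s \<ge> cont_value M \<pi> (induced_stop M \<pi>) k s (\<pi> k s)"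
proof -
  define j where "j = horizon M - Suc k"
  have j: "horizon M - Suc j = k" "Suc j \<le> horizon M" "horizon M - j = Suc k"
    using assms by (auto simp: j_def)
  have "stage_value M \<pi> (stop_from M \<pi> j) (Suc k) = stage_value M \<pi> (induced_stop M \<pi>) (Suc k)"
    unfolding induced_stop_def
    by (intro stage_value_cong fun_cong[OF stop_from_stable[symmetric]]) (use j in auto)
  then have "cont_value M \<pi> (stop_from M \<pi> j) k = cont_value M \<pi> (induced_stop M \<pi>) k"
    by (simp add: cont_value_def)
  moreover have "induced_stop M \<pi> k = stop_from M \<pi> (Suc j) k"
    unfolding induced_stop_def by (rule stop_from_stable) (use j assms in auto)
  ultimately show ?thesis
    using j by (simp add: Let_def)
qed

text \<open>
  The parameter blocks \<open>w\<^sub>0, \<dots>, w\<^sub>N\<^sub>-\<^sub>1\<close> are concatenated into one vector \<open>w\<close>, and \<open>blk i\<close> is the stage to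
  whose block the coordinate \<open>i\<close> belongs, so that blocks may have different dimensions.
\<close>

definition parameterized_policy ::
    "('s, 'p::finite, 'd::finite, 'n::finite) oed \<Rightarrow> ('m::finite \<Rightarrow> nat) \<Rightarrow>
     (real ^ 'm \<Rightarrow> ('s, 'd) design_policy) \<Rightarrow> bool"
  where "parameterized_policy M blk \<mu> \<longleftrightarrow>
    (\<forall>k < horizon M.
       (\<forall>w. \<mu> w k \<in> states M \<rightarrow>\<^sub>M restrict_space borel (designs M k)) \<and>
       (\<forall>w w'. \<forall>s \<in> space (states M). (\<forall>i. blk i = k \<longrightarrow> w $ i = w' $ i) \<longrightarrow> \<mu> w k s = \<mu> w' k s))"

text \<open>
  \<open>g\<close> is the vector of all partial derivatives of \<open>f\<close> at \<open>w\<close>, the derivative in each block \<open>w\<^sub>k\<close> (the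
  others held fixed) being a Frechet derivative. Differentiability in all blocks jointly is not
  claimed: for functions of the form \<open>Q w (\<mu> w)\<close> it does not follow from differentiability of \<open>Q\<close>
  separately in \<open>w\<close> and in the design.
\<close>

definition has_gradient ::
    "('m::finite \<Rightarrow> nat) \<Rightarrow> (real ^ 'm \<Rightarrow> real) \<Rightarrow> real ^ 'm \<Rightarrow> real ^ 'm \<Rightarrow> bool"
  where "has_gradient blk f g w \<longleftrightarrow>
    (\<forall>k. (f has_derivative (\<lambda>h. g \<bullet> h)) (at w within {w'. \<forall>i. blk i \<noteq> k \<longrightarrow> w' $ i = w $ i}))"

text \<open>
  The gradient with respect to the design is taken within the design space, which need not be open.
  On an open design space it is the ordinary gradient.
\<close>

definition design_gradient :: "(real ^ 'd::finite \<Rightarrow> real) \<Rightarrow> (real ^ 'd) filter \<Rightarrow> real ^ 'd"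
  where "design_gradient f F = (\<chi> i. frechet_derivative f F (axis i 1))"

abbreviation value_w ::
    "('s, 'p::finite, 'd::finite, 'n::finite) oed \<Rightarrow> (real ^ 'm::finite \<Rightarrow> ('s, 'd) design_policy) \<Rightarrow>
     real ^ 'm \<Rightarrow> nat \<Rightarrow> 's \<Rightarrow> real"
  where "value_w M \<mu> w \<equiv> stage_value M (\<mu> w) (induced_stop M (\<mu> w))"

abbreviation cont_value_w ::
    "('s, 'p::finite, 'd::finite, 'n::finite) oed \<Rightarrow> (real ^ 'm::finite \<Rightarrow> ('s, 'd) design_policy) \<Rightarrow>
     real ^ 'm \<Rightarrow> nat \<Rightarrow> 's \<Rightarrow> real ^ 'd \<Rightarrow> real"
  where "cont_value_w M \<mu> w \<equiv> cont_value M (\<mu> w) (induced_stop M (\<mu> w))"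

abbreviation law_w ::
    "('s, 'p::finite, 'd::finite, 'n::finite) oed \<Rightarrow> (real ^ 'm::finite \<Rightarrow> ('s, 'd) design_policy) \<Rightarrow>
     real ^ 'm \<Rightarrow> (nat \<Rightarrow> real ^ 'n) measure"
  where "law_w M \<mu> w \<equiv> trajectory_law M (\<mu> w) (induced_stop M (\<mu> w))"

abbreviation state_w ::
    "('s, 'p::finite, 'd::finite, 'n::finite) oed \<Rightarrow> (real ^ 'm::finite \<Rightarrow> ('s, 'd) design_policy) \<Rightarrow>
     real ^ 'm \<Rightarrow> nat \<Rightarrow> (nat \<Rightarrow> real ^ 'n) \<Rightarrow> 's option"
  where "state_w M \<mu> w \<equiv> state_at M (\<mu> w) (induced_stop M (\<mu> w))"

definition on_stopping_boundary ::
    "('s, 'p::finite, 'd::finite, 'n::finite) oed \<Rightarrow> (real ^ 'm::finite \<Rightarrow> ('s, 'd) design_policy) \<Rightarrow>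
     real ^ 'm \<Rightarrow> nat \<Rightarrow> 's \<Rightarrow> bool"
  where "on_stopping_boundary M \<mu> w k s \<longleftrightarrow> stop_reward M s = cont_value_w M \<mu> w k s (\<mu> w k s)"

text \<open>
  For a fixed design the continuation value has a \<open>w\<close>-gradient; whenever its integrand has one for
  almost every observation, differentiation may be carried out inside the expectation. (On the
  stopping boundary the next value function may have a kink.)
\<close>

definition derivative_interchange ::
    "('s, 'p::finite, 'd::finite, 'n::finite) oed \<Rightarrow> ('m::finite \<Rightarrow> nat) \<Rightarrow>
     (real ^ 'm \<Rightarrow> ('s, 'd) design_policy) \<Rightarrow> real ^ 'm \<Rightarrow> nat \<Rightarrow> 's \<Rightarrow> real ^ 'd \<Rightarrow> bool"
  where "derivative_interchange M blk \<mu> w k s \<xi> \<longleftrightarrow>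
    (let integrand = (\<lambda>y w'. cont_reward M k s \<xi> y + value_w M \<mu> w' (Suc k) (evolve M k s \<xi> y))
     in (\<exists>q. has_gradient blk (\<lambda>w'. cont_value_w M \<mu> w' k s \<xi>) q w) \<and>
        ((AE y in predictive M k s \<xi>. \<exists>g. has_gradient blk (integrand y) g w) \<longrightarrow>
         (\<exists>g. integrable (predictive M k s \<xi>) g \<and>
              (AE y in predictive M k s \<xi>. has_gradient blk (integrand y) (g y) w) \<and>
              has_gradient blk (\<lambda>w'. cont_value_w M \<mu> w' k s \<xi>)
                (LINT y|predictive M k s \<xi>. g y) w)))"

text \<open>\<open>1\<^bsub>k < \<tau>\<^esub> \<nabla>\<^sub>w \<mu>(s\<^sub>k) \<cdot> \<nabla>\<^sub>\<xi> Q\<close> along the trajectory with observations \<open>y\<close>.\<close>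

definition gradient_integrand ::
    "('s, 'p::finite, 'd::finite, 'n::finite) oed \<Rightarrow> (real ^ 'm::finite \<Rightarrow> ('s, 'd) design_policy) \<Rightarrow>
     real ^ 'm \<Rightarrow> nat \<Rightarrow> (nat \<Rightarrow> real ^ 'n) \<Rightarrow> real ^ 'm"
  where "gradient_integrand M \<mu> w k y =
    (if k < stopping_time M (\<mu> w) (induced_stop M (\<mu> w)) y then
       (let s = the (state_w M \<mu> w k y)
        in transpose (jacobian (\<lambda>w'. \<mu> w' k s) (at w)) *v
             design_gradient (cont_value_w M \<mu> w k s) (at (\<mu> w k s) within designs M k))
     else 0)"

end

theory Submission
  imports Defs
begin

text \<open>
  Freezing all blocks of \<open>w\<close> but one, the stage-\<open>k\<close> continuation value depends on \<open>w\<close> either through the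
  current design or through the later policies, so off the stopping boundary the gradient of the value
  at a continuing state \<open>s\<^sub>k\<close> is \<open>\<nabla>\<mu> \<cdot> \<nabla>\<^sub>\<xi> Q\<close> plus the conditional expectation of the gradient of the value at
  \<open>s\<^sub>k\<^sub>+\<^sub>1\<close>; at a stopping state it is \<open>0\<close>. The stopping rule contributes nothing, because the value is the maximum of
  the stopping reward and the continuation value and the former does not depend on \<open>w\<close>. Unrolling
  this recursion backward along the trajectory law gives the formula. Only almost every trajectory
  avoids the boundary, so the recursion is run on functions of the observations; the gradients
  provided by the interchange hypothesis are matched with them by uniqueness of the gradient.
\<close>

section \<open>Integration against a composition of kernels\<close>

text \<open>Tonelli's theorem for the norm of \<open>f\<close>: the iterated integral of the norm
  equals its integral against the composition and so is finite. Hence almost every inner integral of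
  the norm is finite, and it dominates the norm of the inner integral.\<close>

lemma
  fixes f :: "'b \<Rightarrow> 'c::{banach, second_countable_topology}"
  assumes N: "N \<in> M \<rightarrow>\<^sub>M subprob_algebra B" and ne: "space M \<noteq> {}"
    and f: "integrable (M \<bind> N) f"
  shows AE_integrable_bind: "AE x in M. integrable (N x) f"
    and integrable_bind_inner: "integrable M (\<lambda>x. LINT y|N x. f y)"
proof -
  have sets_bind_eq: "sets (M \<bind> N) = sets B"
    using N ne by (intro sets_bind) (auto dest: sets_kernel)
  have fB [measurable]: "f \<in> borel_measurable B"
    using borel_measurable_integrable[OF f] by (simp add: measurable_cong_sets[OF sets_bind_eq refl])
  have meas_N: "f \<in> borel_measurable (N x)" if "x \<in> space M" for x
    using fB by (simp add: measurable_cong_sets[OF sets_kernel[OF N that] refl])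
  have "(\<integral>\<^sup>+x. \<integral>\<^sup>+y. ennreal (norm (f y)) \<partial>N x \<partial>M) = (\<integral>\<^sup>+y. ennreal (norm (f y)) \<partial>(M \<bind> N))"
    by (rule nn_integral_bind[OF _ N, symmetric]) simp
  then have fin: "(\<integral>\<^sup>+x. \<integral>\<^sup>+y. ennreal (norm (f y)) \<partial>N x \<partial>M) < \<infinity>"
    using f by (simp add: integrable_iff_bounded)
  have meas: "(\<lambda>x. \<integral>\<^sup>+y. ennreal (norm (f y)) \<partial>N x) \<in> borel_measurable M"
    by (rule measurable_compose[OF N nn_integral_measurable_subprob_algebra]) simp
  then have "AE x in M. (\<integral>\<^sup>+y. ennreal (norm (f y)) \<partial>N x) \<noteq> \<infinity>"
    using fin by (intro nn_integral_PInf_AE) auto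
  then show ae: "AE x in M. integrable (N x) f"
    using AE_space by eventually_elim (auto simp: integrable_iff_bounded meas_N less_top)
  have "(\<integral>\<^sup>+x. ennreal (norm (LINT y|N x. f y)) \<partial>M) \<le> (\<integral>\<^sup>+x. \<integral>\<^sup>+y. ennreal (norm (f y)) \<partial>N x \<partial>M)"
    using ae by (intro nn_integral_mono_AE)
      (auto elim!: eventually_mono intro: integral_norm_bound_ennreal)
  moreover have "(\<lambda>x. LINT y|N x. f y) \<in> borel_measurable M"
    by (rule measurable_compose[OF N integral_measurable_subprob_algebra]) simp
  ultimately show "integrable M (\<lambda>x. LINT y|N x. f y)"
    using fin by (auto simp: integrable_iff_bounded)
qed

text \<open>Nonnegative integrands can be moved to the extended nonnegative integral, where the
  composition formula holds without integrability. Signed functions follow by positive and negative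
  parts, vector-valued ones by coordinates.\<close>

lemma integral_bind_nonneg:
  fixes f :: "'b \<Rightarrow> real"
  assumes N: "N \<in> M \<rightarrow>\<^sub>M subprob_algebra B" and ne: "space M \<noteq> {}"
    and f: "integrable (M \<bind> N) f" and nonneg: "\<And>y. 0 \<le> f y"
  shows "(LINT y|(M \<bind> N). f y) = (LINT x|M. LINT y|N x. f y)"
proof -
  have sets_bind_eq: "sets (M \<bind> N) = sets B"
    using N ne by (intro sets_bind) (auto dest: sets_kernel)
  have fB [measurable]: "f \<in> borel_measurable B"
    using borel_measurable_integrable[OF f] by (simp add: measurable_cong_sets[OF sets_bind_eq refl])
  have "ennreal (LINT y|(M \<bind> N). f y) = (\<integral>\<^sup>+y. ennreal (f y) \<partial>(M \<bind> N))"
    using nonneg by (intro nn_integral_eq_integral[symmetric] f) auto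
  also have "\<dots> = (\<integral>\<^sup>+x. \<integral>\<^sup>+y. ennreal (f y) \<partial>N x \<partial>M)"
    by (rule nn_integral_bind[OF _ N]) simp
  also have "\<dots> = (\<integral>\<^sup>+x. ennreal (LINT y|N x. f y) \<partial>M)"
    using AE_integrable_bind[OF N ne f] nonneg
    by (intro nn_integral_cong_AE) (auto elim!: eventually_mono intro!: nn_integral_eq_integral)
  also have "\<dots> = ennreal (LINT x|M. LINT y|N x. f y)"
    using integrable_bind_inner[OF N ne f] nonneg by (intro nn_integral_eq_integral) auto
  finally show ?thesis
    using nonneg by (simp add: integral_nonneg_AE)
qed

lemma integral_bind_real:
  fixes f :: "'b \<Rightarrow> real"
  assumes N: "N \<in> M \<rightarrow>\<^sub>M subprob_algebra B" and ne: "space M \<noteq> {}"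
    and f: "integrable (M \<bind> N) f"
  shows "(LINT y|(M \<bind> N). f y) = (LINT x|M. LINT y|N x. f y)"
proof -
  let ?p = "\<lambda>y. max 0 (f y)" and ?n = "\<lambda>y. max 0 (- f y)"
  have p: "integrable (M \<bind> N) ?p" and n: "integrable (M \<bind> N) ?n"
    using f by auto
  have f_eq: "f = (\<lambda>y. ?p y - ?n y)"
    by auto
  have "(LINT y|(M \<bind> N). f y) = (LINT y|(M \<bind> N). ?p y) - (LINT y|(M \<bind> N). ?n y)"
    by (subst f_eq) (rule Bochner_Integration.integral_diff[OF p n])
  also have "\<dots> = (LINT x|M. LINT y|N x. ?p y) - (LINT x|M. LINT y|N x. ?n y)"
    by (simp add: integral_bind_nonneg[OF N ne p] integral_bind_nonneg[OF N ne n])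
  also have "\<dots> = (LINT x|M. (LINT y|N x. ?p y) - (LINT y|N x. ?n y))"
    by (intro Bochner_Integration.integral_diff[symmetric] integrable_bind_inner[OF N ne] p n)
  also have "\<dots> = (LINT x|M. LINT y|N x. f y)"
  proof (rule integral_cong_AE)
    show "AE x in M. (LINT y|N x. ?p y) - (LINT y|N x. ?n y) = (LINT y|N x. f y)"
      using AE_integrable_bind[OF N ne p] AE_integrable_bind[OF N ne n]
    proof eventually_elim
      case (elim x)
      then show ?case
        by (subst f_eq, subst Bochner_Integration.integral_diff) auto
    qed
  qed (use integrable_bind_inner[OF N ne p] integrable_bind_inner[OF N ne n]
        integrable_bind_inner[OF N ne f] in auto)
  finally show ?thesis .
qed

lemma integral_bind_euclidean:
  fixes f :: "'b \<Rightarrow> 'c::euclidean_space"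
  assumes N: "N \<in> M \<rightarrow>\<^sub>M subprob_algebra B" and ne: "space M \<noteq> {}"
    and f: "integrable (M \<bind> N) f"
  shows "(LINT y|(M \<bind> N). f y) = (LINT x|M. LINT y|N x. f y)"
proof (rule euclidean_eqI)
  fix b :: 'c
  have fb: "integrable (M \<bind> N) (\<lambda>y. f y \<bullet> b)"
    using f by simp
  note inner = integrable_bind_inner[OF N ne f]
  have "(LINT y|(M \<bind> N). f y) \<bullet> b = (LINT y|(M \<bind> N). f y \<bullet> b)"
    using f by simp
  also have "\<dots> = (LINT x|M. LINT y|N x. f y \<bullet> b)"
    by (rule integral_bind_real[OF N ne fb])
  also have "\<dots> = (LINT x|M. (LINT y|N x. f y) \<bullet> b)"
  proof (rule integral_cong_AE)
    show "AE x in M. (LINT y|N x. f y \<bullet> b) = (LINT y|N x. f y) \<bullet> b"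
      using AE_integrable_bind[OF N ne f] by eventually_elim simp
  qed (use integrable_bind_inner[OF N ne fb] inner in \<open>auto dest!: borel_measurable_integrable\<close>)
  also have "\<dots> = (LINT x|M. LINT y|N x. f y) \<bullet> b"
    using inner by simp
  finally show "(LINT y|(M \<bind> N). f y) \<bullet> b = (LINT x|M. LINT y|N x. f y) \<bullet> b" .
qed

text \<open>Both the kernel and the integrand vary with \<open>x\<close>. Pushing \<open>L x\<close>
  forward along \<open>Pair x\<close> to the product space turns the integrand into one fixed
  function, so that only the kernel still varies.\<close>

lemma integral_measurable_subprob_algebra2:
  fixes f :: "'a \<Rightarrow> 'b \<Rightarrow> 'c::{banach, second_countable_topology}"
  assumes f: "(\<lambda>(x, y). f x y) \<in> borel_measurable (M \<Otimes>\<^sub>M N)"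
    and L: "L \<in> M \<rightarrow>\<^sub>M subprob_algebra N"
  shows "(\<lambda>x. integral\<^sup>L (L x) (f x)) \<in> borel_measurable M"
proof -
  have "(\<lambda>x. distr (L x) (M \<Otimes>\<^sub>M N) (Pair x)) \<in> M \<rightarrow>\<^sub>M subprob_algebra (M \<Otimes>\<^sub>M N)"
    by (rule measurable_distr2[OF _ L]) simp
  from measurable_compose[OF this integral_measurable_subprob_algebra[OF f]]
  have "(\<lambda>x. LINT z|distr (L x) (M \<Otimes>\<^sub>M N) (Pair x). (case z of (x, y) \<Rightarrow> f x y)) \<in> borel_measurable M" .
  moreover have "(LINT z|distr (L x) (M \<Otimes>\<^sub>M N) (Pair x). (case z of (x, y) \<Rightarrow> f x y)) = integral\<^sup>L (L x) (f x)"
    if x: "x \<in> space M" for x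
  proof -
    have "Pair x \<in> L x \<rightarrow>\<^sub>M M \<Otimes>\<^sub>M N"
      using x by (simp add: measurable_cong_sets[OF sets_kernel[OF L x] refl])
    then show ?thesis
      using f by (subst integral_distr) auto
  qed
  ultimately show ?thesis
    by (simp cong: measurable_cong)
qed

text \<open>\<open>AE_bind\<close> asks for a measurable predicate, and having a given gradient is
  not known to be one. It is therefore applied to the complement of a measurable null set that
  covers the failures of \<open>P\<close>.\<close>

lemma AE_bind_imp:
  assumes N: "N \<in> M \<rightarrow>\<^sub>M subprob_algebra B" and ne: "space M \<noteq> {}"
    and P: "AE y in M \<bind> N. P y"
  shows "AE x in M. AE y in N x. P y"
proof -
  have sets_bind_eq: "sets (M \<bind> N) = sets B"
    using N ne by (intro sets_bind) (auto dest: sets_kernel)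
  then have sp: "space (M \<bind> N) = space B"
    by (rule sets_eq_imp_space_eq)
  obtain Z where Z: "{y \<in> space (M \<bind> N). \<not> P y} \<subseteq> Z" "emeasure (M \<bind> N) Z = 0" "Z \<in> sets (M \<bind> N)"
    using P by (rule AE_E)
  have ZB [measurable]: "Z \<in> sets B"
    using Z(3) sets_bind_eq by simp
  have "AE y in M \<bind> N. y \<notin> Z"
    using Z by (intro AE_not_in null_setsI) auto
  then have "AE x in M. AE y in N x. y \<notin> Z"
    by (subst (asm) AE_bind[OF N]) simp_all
  then show ?thesis
    using AE_space
  proof eventually_elim
    case (elim x)
    have "space (N x) = space B"
      using sets_kernel[OF N elim(2)] by (rule sets_eq_imp_space_eq)
    then have "y \<notin> Z \<longrightarrow> P y" if "y \<in> space (N x)" for y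
      using that Z(1) sp by auto
    then have "AE y in N x. y \<notin> Z \<longrightarrow> P y"
      by (rule AE_I2)
    with elim(1) show ?case
      by (rule AE_mp)
  qed
qed

section \<open>Blockwise gradients\<close>

text \<open>The line through \<open>w\<close> in direction \<open>i\<close> stays inside the set
  where only the block of \<open>i\<close> moves. The blockwise derivatives thus determine every
  partial derivative.\<close>

lemma has_gradient_unique:
  assumes g: "has_gradient blk f g w" and g': "has_gradient blk f g' w"
  shows "g = g'"
proof (rule vec_eq_iff[THEN iffD2], rule allI)
  fix i
  define S where "S = {w'. \<forall>j. blk j \<noteq> blk i \<longrightarrow> w' $ j = w $ j}"
  have c: "((\<lambda>t. w + t *\<^sub>R axis i 1) has_derivative (\<lambda>t. t *\<^sub>R axis i 1)) (at (0::real))"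
    by (auto intro!: derivative_eq_intros)
  have sub: "range (\<lambda>t. w + t *\<^sub>R axis i 1) \<subseteq> S"
    by (auto simp: S_def axis_def)
  have D: "((\<lambda>t. f (w + t *\<^sub>R axis i 1)) has_derivative (\<lambda>t. h \<bullet> (t *\<^sub>R axis i 1))) (at 0)"
    if "has_gradient blk f h w" for h
  proof -
    have "(f has_derivative (\<lambda>v. h \<bullet> v)) (at w within S)"
      using that by (auto simp: has_gradient_def S_def)
    then have "(f has_derivative (\<lambda>v. h \<bullet> v)) (at (w + 0 *\<^sub>R axis i 1) within range (\<lambda>t. w + t *\<^sub>R axis i 1))"
      using sub by (auto intro: has_derivative_subset)
    from diff_chain_within[OF c this] show ?thesis
      by (simp add: o_def)
  qed
  have "(\<lambda>t::real. g \<bullet> (t *\<^sub>R axis i 1)) = (\<lambda>t. g' \<bullet> (t *\<^sub>R axis i 1))"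
    using D[OF g] D[OF g'] by (rule has_derivative_unique)
  from fun_cong[OF this, of 1] show "g $ i = g' $ i"
    by (simp add: inner_axis)
qed

text \<open>Agreement is required only where a single block moves. This admits decompositions that
  fail as soon as two blocks move together.\<close>

lemma has_gradient_cong_block:
  assumes f: "has_gradient blk f g w"
    and eq: "\<And>k w'. (\<And>i. blk i \<noteq> k \<Longrightarrow> w' $ i = w $ i) \<Longrightarrow> f' w' = f w'"
  shows "has_gradient blk f' g w"
  unfolding has_gradient_def
proof
  fix k
  let ?S = "{w'. \<forall>i. blk i \<noteq> k \<longrightarrow> w' $ i = w $ i}"
  show "(f' has_derivative (\<lambda>h. g \<bullet> h)) (at w within ?S)"
    by (rule has_derivative_transform[where f=f]) (use f eq in \<open>auto simp: has_gradient_def\<close>)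
qed

text \<open>Without a tie at \<open>w\<close>, continuity of \<open>f\<close> along each block
  preserves the strict inequality nearby, so the maximum coincides locally with one of its
  arguments. Excluding the tie excludes the kink.\<close>

lemma has_gradient_max_const:
  assumes f: "has_gradient blk f g w" and ne: "f w \<noteq> c"
  shows "has_gradient blk (\<lambda>w'. max c (f w')) (if f w < c then 0 else g) w"
  unfolding has_gradient_def
proof
  fix k
  let ?F = "at w within {w'. \<forall>i. blk i \<noteq> k \<longrightarrow> w' $ i = w $ i}"
  have D: "(f has_derivative (\<lambda>h. g \<bullet> h)) ?F"
    using f by (simp add: has_gradient_def)
  then have lim: "(f \<longlongrightarrow> f w) ?F"
    by (auto dest!: has_derivative_continuous simp: continuous_within)
  show "((\<lambda>w'. max c (f w')) has_derivative (\<lambda>h. (if f w < c then 0 else g) \<bullet> h)) ?F"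
  proof (cases "f w < c")
    case True
    then have "\<forall>\<^sub>F w' in ?F. c = max c (f w')"
      using order_tendstoD(2)[OF lim True] by (auto elim!: eventually_mono)
    then have "((\<lambda>w'. max c (f w')) has_derivative (\<lambda>h. 0)) ?F"
      by (rule has_derivative_transform_eventually[rotated]) (use True in auto)
    then show ?thesis
      using True by simp
  next
    case False
    then have "c < f w"
      using ne by simp
    have "\<forall>\<^sub>F w' in ?F. f w' = max c (f w')"
      using order_tendstoD(1)[OF lim \<open>c < f w\<close>] by (auto elim!: eventually_mono)
    then have "((\<lambda>w'. max c (f w')) has_derivative (\<lambda>h. g \<bullet> h)) ?F"
      by (rule has_derivative_transform_eventually[OF D]) (use \<open>c < f w\<close> in auto)
    then show ?thesis
      using False by simp
  qed
qed

lemma has_gradient_add: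
  assumes "has_gradient blk f g w" and "has_gradient blk f' g' w"
  shows "has_gradient blk (\<lambda>w'. f w' + f' w') (g + g') w"
  using assms by (auto simp: has_gradient_def inner_add_left intro!: derivative_intros)

lemma has_gradient_add_const_iff:
  "has_gradient blk (\<lambda>w'. c + f w') g w \<longleftrightarrow> has_gradient blk f g w"
proof
  have const: "has_gradient blk (\<lambda>_. a) 0 w" for a
    by (simp add: has_gradient_def)
  show "has_gradient blk f g w" if "has_gradient blk (\<lambda>w'. c + f w') g w"
    using has_gradient_add[OF const[of "- c"] that] by simp
  show "has_gradient blk (\<lambda>w'. c + f w') g w" if "has_gradient blk f g w"
    using has_gradient_add[OF const[of c] that] by simp
qed

lemma frechet_derivative_eq_design_gradient:
  assumes "f differentiable F"
  shows "frechet_derivative f F h = design_gradient f F \<bullet> h"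
proof -
  have "linear (frechet_derivative f F)"
    using assms by (auto simp: frechet_derivative_works intro: has_derivative_linear)
  then have "frechet_derivative f F h = (\<Sum>i\<in>UNIV. h $ i * frechet_derivative f F (axis i 1))"
    by (subst basis_expansion[symmetric, of h])
      (simp add: linear_sum linear_cmul scalar_mult_eq_scaleR)
  then show ?thesis
    by (simp add: design_gradient_def inner_vec_def mult.commute)
qed

text \<open>
  The design space need not be open, but the policy takes values in it, so differentiability of \<open>f\<close>
  within it suffices; the choice made by \<open>design_gradient\<close> among several derivatives does not matter.
\<close>

lemma has_gradient_compose_design:
  fixes \<mu> :: "real ^ 'm::finite \<Rightarrow> real ^ 'd::finite"
  assumes \<mu>: "\<mu> differentiable (at w)" and D: "range \<mu> \<subseteq> D"
    and f: "f differentiable (at (\<mu> w) within D)"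
  shows "has_gradient blk (\<lambda>w'. f (\<mu> w'))
           (transpose (jacobian \<mu> (at w)) *v design_gradient f (at (\<mu> w) within D)) w"
  unfolding has_gradient_def
proof
  fix k
  let ?S = "{w'. \<forall>i. blk i \<noteq> k \<longrightarrow> w' $ i = w $ i}"
  have "(\<mu> has_derivative (\<lambda>h. jacobian \<mu> (at w) *v h)) (at w)"
    using \<mu> by (simp add: jacobian_works)
  then have "(\<mu> has_derivative (\<lambda>h. jacobian \<mu> (at w) *v h)) (at w within ?S)"
    by (rule has_derivative_at_withinI)
  moreover have "(f has_derivative (\<lambda>h. design_gradient f (at (\<mu> w) within D) \<bullet> h)) (at (\<mu> w) within D)"
    using f unfolding frechet_derivative_works
    by (simp add: frechet_derivative_eq_design_gradient[OF f, abs_def])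
  then have "(f has_derivative (\<lambda>h. design_gradient f (at (\<mu> w) within D) \<bullet> h)) (at (\<mu> w) within \<mu> ` ?S)"
    by (rule has_derivative_subset) (use D in auto)
  ultimately have "(f \<circ> \<mu> has_derivative
      (\<lambda>h. design_gradient f (at (\<mu> w) within D) \<bullet> h) \<circ> (\<lambda>h. jacobian \<mu> (at w) *v h)) (at w within ?S)"
    by (rule diff_chain_within)
  then show "((\<lambda>w'. f (\<mu> w')) has_derivative
      (\<lambda>h. (transpose (jacobian \<mu> (at w)) *v design_gradient f (at (\<mu> w) within D)) \<bullet> h)) (at w within ?S)"
    by (simp add: o_def dot_lmul_matrix transpose_matrix_vector)
qed

section \<open>Measurability of the model\<close>

locale oed_setting =
  fixes M :: "('s, 'p::finite, 'd::finite, 'n::finite) oed"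
  assumes model: "oed_model M"
begin

lemma noise_measurable [measurable]: "noise M \<in> borel_measurable borel"
  and noise_nonneg: "0 \<le> noise M e"
  and noise_prob: "prob_space (density lborel (\<lambda>e. ennreal (noise M e)))"
  and init_space: "init M \<in> space (states M)"
  and stop_reward_measurable [measurable]: "stop_reward M \<in> borel_measurable (states M)"
  using model by (auto simp: oed_model_def)

lemma belief_nonneg: "s \<in> space (states M) \<Longrightarrow> 0 \<le> belief M s \<theta>"
  and belief_prob: "s \<in> space (states M) \<Longrightarrow> prob_space (density lborel (\<lambda>\<theta>. ennreal (belief M s \<theta>)))"
  using model by (auto simp: oed_model_def)

lemma belief_measurable [measurable (raw)]:
  assumes "h \<in> A \<rightarrow>\<^sub>M states M" and "f \<in> A \<rightarrow>\<^sub>M borel"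
  shows "(\<lambda>x. belief M (h x) (f x)) \<in> borel_measurable A"
proof -
  have "(\<lambda>(s, \<theta>). belief M s \<theta>) \<in> borel_measurable (states M \<Otimes>\<^sub>M borel)"
    using model by (simp add: oed_model_def)
  from measurable_compose[OF measurable_Pair[OF assms] this] show ?thesis
    by simp
qed

lemma forward_measurable:
  assumes k: "k < horizon M" and "f \<in> A \<rightarrow>\<^sub>M borel"
    and "g \<in> A \<rightarrow>\<^sub>M restrict_space borel (designs M k)" and "h \<in> A \<rightarrow>\<^sub>M states M"
  shows "(\<lambda>x. forward M k (f x) (g x) (h x)) \<in> borel_measurable A"
proof -
  have "(\<lambda>(\<theta>, \<xi>, s). forward M k \<theta> \<xi> s)
      \<in> borel_measurable (borel \<Otimes>\<^sub>M restrict_space borel (designs M k) \<Otimes>\<^sub>M states M)"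
    using model k by (simp add: oed_model_def)
  from measurable_compose[OF measurable_Pair[OF assms(2) measurable_Pair[OF assms(3,4)]] this]
  show ?thesis
    by simp
qed

lemma evolve_measurable:
  assumes k: "k < horizon M" and "h \<in> A \<rightarrow>\<^sub>M states M"
    and "g \<in> A \<rightarrow>\<^sub>M restrict_space borel (designs M k)" and "f \<in> A \<rightarrow>\<^sub>M borel"
  shows "(\<lambda>x. evolve M k (h x) (g x) (f x)) \<in> A \<rightarrow>\<^sub>M states M"
proof -
  have "(\<lambda>(s, \<xi>, y). evolve M k s \<xi> y)
      \<in> states M \<Otimes>\<^sub>M restrict_space borel (designs M k) \<Otimes>\<^sub>M borel \<rightarrow>\<^sub>M states M"
    using model k by (simp add: oed_model_def)
  from measurable_compose[OF measurable_Pair[OF assms(2) measurable_Pair[OF assms(3,4)]] this]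
  show ?thesis
    by simp
qed

lemma cont_reward_measurable:
  assumes k: "k < horizon M" and "h \<in> A \<rightarrow>\<^sub>M states M"
    and "g \<in> A \<rightarrow>\<^sub>M restrict_space borel (designs M k)" and "f \<in> A \<rightarrow>\<^sub>M borel"
  shows "(\<lambda>x. cont_reward M k (h x) (g x) (f x)) \<in> borel_measurable A"
proof -
  have "(\<lambda>(s, \<xi>, y). cont_reward M k s \<xi> y)
      \<in> borel_measurable (states M \<Otimes>\<^sub>M restrict_space borel (designs M k) \<Otimes>\<^sub>M borel)"
    using model k by (simp add: oed_model_def)
  from measurable_compose[OF measurable_Pair[OF assms(2) measurable_Pair[OF assms(3,4)]] this]
  show ?thesis
    by simp
qed

lemma evolve_space:
  assumes "k < horizon M" and "s \<in> space (states M)" and "\<xi> \<in> designs M k"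
  shows "evolve M k s \<xi> y \<in> space (states M)"
proof -
  \<comment> \<open>Measurability speaks about maps; a constant map on a nonempty space turns it
    into a membership statement.\<close>
  have "(\<lambda>x::real. evolve M k s \<xi> y) \<in> borel \<rightarrow>\<^sub>M states M"
    using assms by (intro evolve_measurable measurable_const) (auto simp: space_restrict_space)
  then show ?thesis
    by (auto dest: measurable_space)
qed

lemma likelihood_measurable:
  assumes "k < horizon M" and f: "f \<in> A \<rightarrow>\<^sub>M borel" and "t \<in> A \<rightarrow>\<^sub>M borel"
    and "g \<in> A \<rightarrow>\<^sub>M restrict_space borel (designs M k)" and "h \<in> A \<rightarrow>\<^sub>M states M"
  shows "(\<lambda>x. likelihood M k (f x) (t x) (g x) (h x)) \<in> borel_measurable A"
  unfolding likelihood_def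
  by (intro measurable_compose[OF _ noise_measurable] borel_measurable_diff f
      forward_measurable assms)

lemma evidence_measurable:
  assumes k: "k < horizon M" and f: "f \<in> A \<rightarrow>\<^sub>M borel"
    and g: "g \<in> A \<rightarrow>\<^sub>M restrict_space borel (designs M k)" and h: "h \<in> A \<rightarrow>\<^sub>M states M"
  shows "(\<lambda>x. evidence M k (f x) (g x) (h x)) \<in> borel_measurable A"
  unfolding evidence_def
proof (rule lborel.borel_measurable_lebesgue_integral)
  have "(\<lambda>x. likelihood M k (f (fst x)) (snd x) (g (fst x)) (h (fst x)) * belief M (h (fst x)) (snd x))
      \<in> borel_measurable (A \<Otimes>\<^sub>M lborel)"
    by (intro borel_measurable_times likelihood_measurable[OF k] belief_measurable
        measurable_compose[OF measurable_fst] f g h measurable_snd) simp_all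
  then show "(\<lambda>(x, \<theta>). likelihood M k (f x) \<theta> (g x) (h x) * belief M (h x) \<theta>)
      \<in> borel_measurable (A \<Otimes>\<^sub>M lborel)"
    by (simp add: case_prod_beta')
qed

text \<open>By Tonelli the joint density of parameter and observation may be integrated over the
  observation first. Each translate of the noise density has mass one, which leaves the mass of the
  belief.\<close>

lemma predictive_prob:
  assumes k: "k < horizon M" and s: "s \<in> space (states M)" and \<xi>: "\<xi> \<in> designs M k"
  shows "prob_space (predictive M k s \<xi>)"
proof
  define L where "L = (\<lambda>y \<theta>. likelihood M k y \<theta> \<xi> s * belief M s \<theta>)"
  have const: "(\<lambda>_. \<xi>) \<in> A \<rightarrow>\<^sub>M restrict_space borel (designs M k)" "(\<lambda>_. s) \<in> A \<rightarrow>\<^sub>M states M" for A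
    using s \<xi> by (auto intro!: measurable_const simp: space_restrict_space)
  have L_meas [measurable]: "(\<lambda>x. L (fst x) (snd x)) \<in> borel_measurable (borel \<Otimes>\<^sub>M borel)"
    unfolding L_def by (intro borel_measurable_times likelihood_measurable[OF k] belief_measurable const
        measurable_fst measurable_snd)
  have L_meas': "(\<lambda>x. L (snd x) (fst x)) \<in> borel_measurable (borel \<Otimes>\<^sub>M borel)"
    unfolding L_def by (intro borel_measurable_times likelihood_measurable[OF k] belief_measurable const
        measurable_fst measurable_snd)
  have belief_meas [measurable]: "belief M s \<in> borel_measurable borel"
    by (intro belief_measurable const measurable_ident_sets[OF refl])
  have L_nonneg: "0 \<le> L y \<theta>" for y \<theta>
    using belief_nonneg[OF s] noise_nonneg by (simp add: L_def likelihood_def)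
  have total_noise: "(\<integral>\<^sup>+e. ennreal (noise M e) \<partial>lborel) = 1"
    using prob_space.emeasure_space_1[OF noise_prob] by (simp add: emeasure_density)
  have total_belief: "(\<integral>\<^sup>+\<theta>. ennreal (belief M s \<theta>) \<partial>lborel) = 1"
    using prob_space.emeasure_space_1[OF belief_prob[OF s]] by (simp add: emeasure_density)
  have shift: "(\<integral>\<^sup>+y. ennreal (noise M (y - c)) \<partial>lborel) = 1" for c
  proof -
    have "(\<integral>\<^sup>+y. ennreal (noise M (y - c)) \<partial>lborel)
        = (\<integral>\<^sup>+e. ennreal (noise M e) \<partial>distr lborel borel ((+) (- c)))"
      by (subst nn_integral_distr) (auto simp: algebra_simps)
    then show ?thesis
      by (simp add: lborel_distr_plus total_noise)
  qed
  have "(\<integral>\<^sup>+y. \<integral>\<^sup>+\<theta>. ennreal (L y \<theta>) \<partial>lborel \<partial>lborel)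
      = (\<integral>\<^sup>+\<theta>. \<integral>\<^sup>+y. ennreal (L y \<theta>) \<partial>lborel \<partial>lborel)"
    by (rule lborel_pair.Fubini')
      (use L_meas' in \<open>simp add: case_prod_beta' measurable_cong_sets[OF sets_pair_measure_cong[OF sets_lborel sets_lborel] refl]\<close>)
  also have "\<dots> = (\<integral>\<^sup>+\<theta>. ennreal (belief M s \<theta>) * (\<integral>\<^sup>+y. ennreal (noise M (y - forward M k \<theta> \<xi> s)) \<partial>lborel) \<partial>lborel)"
    by (intro nn_integral_cong, subst nn_integral_cmult[symmetric])
      (auto simp: L_def likelihood_def ennreal_mult belief_nonneg[OF s] noise_nonneg mult.commute)
  finally have one: "(\<integral>\<^sup>+y. \<integral>\<^sup>+\<theta>. ennreal (L y \<theta>) \<partial>lborel \<partial>lborel) = 1"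
    by (simp add: shift total_belief)
  \<comment> \<open>\<open>evidence\<close> is a Bochner integral, with value 0 where the joint
    density is not integrable in the parameter. Finiteness of the total mass confines this default
    to a null set.\<close>
  have "AE y in lborel. (\<integral>\<^sup>+\<theta>. ennreal (L y \<theta>) \<partial>lborel) \<noteq> \<infinity>"
    using one by (intro nn_integral_PInf_AE) auto
  then have "AE y in lborel. ennreal (evidence M k y \<xi> s) = (\<integral>\<^sup>+\<theta>. ennreal (L y \<theta>) \<partial>lborel)"
  proof eventually_elim
    case (elim y)
    have "L y \<in> borel_measurable lborel"
      using measurable_compose[OF measurable_Pair1' L_meas, of y] by simp
    then have "integrable lborel (L y)"
      using elim L_nonneg by (intro integrableI_nonneg) (auto simp: less_top)
    then show ?case
      using L_nonneg by (simp add: nn_integral_eq_integral) (simp add: evidence_def L_def)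
  qed
  from nn_integral_cong_AE[OF this] have "(\<integral>\<^sup>+y. ennreal (evidence M k y \<xi> s) \<partial>lborel) = 1"
    using one by simp
  moreover have "(\<lambda>y. evidence M k y \<xi> s) \<in> borel_measurable borel"
    by (intro evidence_measurable[OF k] const measurable_ident_sets[OF refl])
  ultimately show "emeasure (predictive M k s \<xi>) (space (predictive M k s \<xi>)) = 1"
    by (simp add: predictive_def emeasure_density)
qed

lemma sets_predictive [simp]: "sets (predictive M k s \<xi>) = sets borel"
  by (simp add: predictive_def)

lemma predictive_kernel:
  assumes k: "k < horizon M" and h: "h \<in> A \<rightarrow>\<^sub>M states M"
    and g: "g \<in> A \<rightarrow>\<^sub>M restrict_space borel (designs M k)"
  shows "(\<lambda>x. predictive M k (h x) (g x)) \<in> A \<rightarrow>\<^sub>M subprob_algebra borel"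
proof (rule measurable_subprob_algebra)
  fix x assume x: "x \<in> space A"
  have "h x \<in> space (states M)" "g x \<in> designs M k"
    using measurable_space[OF h x] measurable_space[OF g x] by (auto simp: space_restrict_space)
  then show "subprob_space (predictive M k (h x) (g x))"
    by (intro prob_space_imp_subprob_space predictive_prob k)
next
  fix B :: "(real ^ 'n) set" assume B: "B \<in> sets borel"
  have ev: "(\<lambda>z. evidence M k (snd z) (g (fst z)) (h (fst z))) \<in> borel_measurable (A \<Otimes>\<^sub>M lborel)"
    by (intro evidence_measurable[OF k] measurable_compose[OF measurable_fst] g h)
      (simp add: measurable_snd)
  have "(\<lambda>x. \<integral>\<^sup>+y. ennreal (evidence M k y (g x) (h x)) * indicator B y \<partial>lborel) \<in> borel_measurable A"
    by (rule lborel.borel_measurable_nn_integral)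
      (use ev B in \<open>simp add: case_prod_beta'\<close>)
  moreover have "emeasure (predictive M k (h x) (g x)) B
      = (\<integral>\<^sup>+y. ennreal (evidence M k y (g x) (h x)) * indicator B y \<partial>lborel)" if x: "x \<in> space A" for x
  proof -
    have "(\<lambda>y. evidence M k y (g x) (h x)) \<in> borel_measurable borel"
      using measurable_space[OF g x] measurable_space[OF h x]
      by (intro evidence_measurable[OF k] measurable_const measurable_ident_sets[OF refl])
    then show ?thesis
      using B by (simp add: predictive_def emeasure_density)
  qed
  ultimately show "(\<lambda>x. emeasure (predictive M k (h x) (g x)) B) \<in> borel_measurable A"
    by (simp cong: measurable_cong)
qed simp

lemma backup_measurable:
  assumes k: "k < horizon M" and v: "v \<in> borel_measurable (states M)"
    and h: "h \<in> A \<rightarrow>\<^sub>M states M" and g: "g \<in> A \<rightarrow>\<^sub>M restrict_space borel (designs M k)"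
  shows "(\<lambda>x. backup M k v (h x) (g x)) \<in> borel_measurable A"
  unfolding backup_def
proof (rule integral_measurable_subprob_algebra2[OF _ predictive_kernel[OF k h g]])
  have "(\<lambda>z. cont_reward M k (h (fst z)) (g (fst z)) (snd z)
        + v (evolve M k (h (fst z)) (g (fst z)) (snd z))) \<in> borel_measurable (A \<Otimes>\<^sub>M borel)"
    by (intro borel_measurable_add cont_reward_measurable[OF k] measurable_compose[OF _ v]
        evolve_measurable[OF k] measurable_compose[OF measurable_fst] h g measurable_snd)
  then show "(\<lambda>(x, y). cont_reward M k (h x) (g x) y + v (evolve M k (h x) (g x) y))
      \<in> borel_measurable (A \<Otimes>\<^sub>M borel)"
    by (simp add: case_prod_beta')
qed

end

section \<open>Measurability of value functions and of the induced stopping rule\<close>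

locale oed_policy = oed_setting M
  for M :: "('s, 'p::finite, 'd::finite, 'n::finite) oed" +
  fixes \<pi> :: "('s, 'd) design_policy"
  assumes policy_measurable:
    "\<And>k. k < horizon M \<Longrightarrow> \<pi> k \<in> states M \<rightarrow>\<^sub>M restrict_space borel (designs M k)"
begin

lemma policy_design: "k < horizon M \<Longrightarrow> s \<in> space (states M) \<Longrightarrow> \<pi> k s \<in> designs M k"
  using measurable_space[OF policy_measurable, of k s] by (simp add: space_restrict_space)

text \<open>Only the stopping rules from stage \<open>k\<close> on are assumed measurable, so that
  the lemma can serve inside the backward induction for the induced rule.\<close>

lemma stage_value_measurable:
  assumes "k \<le> horizon M"
    and "\<And>l. k \<le> l \<Longrightarrow> l < horizon M \<Longrightarrow> Measurable.pred (states M) (\<phi> l)"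
  shows "stage_value M \<pi> \<phi> k \<in> borel_measurable (states M)"
  using assms
proof (induction rule: inc_induct)
  case base
  then show ?case
    by (simp add: stage_value.simps[abs_def] terminal_reward_def)
next
  case (step k)
  have "Measurable.pred (states M) (\<phi> k)"
    using step by simp
  moreover have "(\<lambda>s. backup M k (stage_value M \<pi> \<phi> (Suc k)) s (\<pi> k s)) \<in> borel_measurable (states M)"
    using step by (intro backup_measurable policy_measurable measurable_ident_sets[OF refl]) auto
  ultimately have "(\<lambda>s. if \<phi> k s then stop_reward M s else backup M k (stage_value M \<pi> \<phi> (Suc k)) s (\<pi> k s))
      \<in> borel_measurable (states M)"
    by simp
  then show ?case
    using step by (subst stage_value.simps[abs_def]) simp
qed

text \<open>The rule at one stage compares the stopping reward with a continuation value that
  involves only later rules. The backward induction therefore carries the claim for all stages from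
  \<open>k\<close> on.\<close>

lemma induced_stop_measurable:
  assumes "k < horizon M"
  shows "Measurable.pred (states M) (induced_stop M \<pi> k)"
proof -
  have "\<forall>l. k \<le> l \<and> l < horizon M \<longrightarrow> Measurable.pred (states M) (induced_stop M \<pi> l)"
    using less_imp_le[OF assms]
  proof (induction rule: inc_induct)
    case base
    then show ?case
      by auto
  next
    case (step k)
    then have "stage_value M \<pi> (induced_stop M \<pi>) (Suc k) \<in> borel_measurable (states M)"
      by (intro stage_value_measurable) auto
    then have "(\<lambda>s. cont_value M \<pi> (induced_stop M \<pi>) k s (\<pi> k s)) \<in> borel_measurable (states M)"
      unfolding cont_value_def
      using step by (intro backup_measurable policy_measurable measurable_ident_sets[OF refl]) auto
    then have "Measurable.pred (states M) (\<lambda>s. cont_value M \<pi> (induced_stop M \<pi>) k s (\<pi> k s) \<le> stop_reward M s)"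
      by simp
    then have "Measurable.pred (states M) (induced_stop M \<pi> k)"
      by (simp add: induced_stop_iff[OF step(2), abs_def])
    with step show ?case
      by (metis Suc_leI le_neq_implies_less)
  qed
  with assms show ?thesis
    by simp
qed

end

section \<open>Disintegration of the trajectory law\<close>

lemma measurable_fun_upd_coordinate:
  assumes "k \<in> I" and "f \<in> A \<rightarrow>\<^sub>M PiM (I - {k}) N" and "g \<in> A \<rightarrow>\<^sub>M N k"
  shows "(\<lambda>x. (f x)(k := g x)) \<in> A \<rightarrow>\<^sub>M PiM I N"
proof -
  have "(\<lambda>(h, z). h(k := z)) \<in> PiM (I - {k}) N \<Otimes>\<^sub>M N k \<rightarrow>\<^sub>M PiM (insert k (I - {k})) N"
    by (rule measurable_add_dim)
  from measurable_compose[OF measurable_Pair[OF assms(2,3)] this] show ?thesis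
    using assms(1) by (simp add: insert_absorb)
qed

locale oed_process = oed_policy M \<pi>
  for M :: "('s, 'p::finite, 'd::finite, 'n::finite) oed" and \<pi> +
  fixes \<phi> :: "'s stopping_policy"
  assumes stop_measurable: "\<And>k. k < horizon M \<Longrightarrow> Measurable.pred (states M) (\<phi> k)"
begin

text \<open>The value \<open>init M\<close> after stopping is a dummy.\<close>

definition current :: "nat \<Rightarrow> (nat \<Rightarrow> real ^ 'n) \<Rightarrow> 's" where
  "current k y = (case state_at M \<pi> \<phi> k y of None \<Rightarrow> init M | Some s \<Rightarrow> s)"

definition continues :: "nat \<Rightarrow> (nat \<Rightarrow> real ^ 'n) \<Rightarrow> bool" where
  "continues k y \<longleftrightarrow> state_at M \<pi> \<phi> k y \<noteq> None \<and> \<not> \<phi> k (current k y)"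

abbreviation obs_space :: "nat \<Rightarrow> (nat \<Rightarrow> real ^ 'n) measure" where
  "obs_space k \<equiv> PiM {..<k} (\<lambda>_. borel)"

lemma state_at_space:
  "k \<le> horizon M \<Longrightarrow> state_at M \<pi> \<phi> k y = Some s \<Longrightarrow> s \<in> space (states M)"
proof (induction k arbitrary: s)
  case 0
  then show ?case
    using init_space by simp
next
  case (Suc k)
  then show ?case
    by (auto split: option.splits if_splits intro!: evolve_space policy_design)
qed

text \<open>The recursion for the state at stage \<open>l\<close> reads only observations with index
  below \<open>l\<close>.\<close>

lemma state_at_fun_upd: "l \<le> k \<Longrightarrow> state_at M \<pi> \<phi> l (y(k := z)) = state_at M \<pi> \<phi> l y"
proof (induction l)
  case (Suc l)
  have "state_at M \<pi> \<phi> l (y(k := z)) = state_at M \<pi> \<phi> l y"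
    by (rule Suc.IH) (use Suc.prems in simp)
  moreover have "l \<noteq> k"
    using Suc.prems by simp
  ultimately show ?case
    by (simp only: state_at.simps fun_upd_other not_False_eq_True)
qed (simp only: state_at.simps)

text \<open>The option-valued state is replaced by the event of not having stopped and a state
  completed by a dummy. Both claims go through one induction: the next event depends on the present
  state, and the next state on that event.\<close>

lemma current_measurable:
  assumes "k \<le> horizon M"
  shows "Measurable.pred (obs_space k) (\<lambda>y. state_at M \<pi> \<phi> k y \<noteq> None)
    \<and> current k \<in> obs_space k \<rightarrow>\<^sub>M states M"
  using assms
proof (induction k)
  case 0
  have "current 0 = (\<lambda>y. init M)"
    by (simp add: current_def fun_eq_iff)
  then show ?case
    using init_space by simp
next
  case (Suc k)
  let ?P = "obs_space (Suc k)"
  \<comment> \<open>The induction hypothesis lives on \<open>k\<close> coordinates. Restriction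
    carries it over to \<open>k + 1\<close> coordinates, because the stage-\<open>k\<close> state
    ignores the last one.\<close>
  have restrict: "(\<lambda>y. restrict y {..<k}) \<in> ?P \<rightarrow>\<^sub>M obs_space k"
    by (rule measurable_restrict_subset) auto
  have restrict_state: "state_at M \<pi> \<phi> l (restrict y {..<k}) = state_at M \<pi> \<phi> l y" if "l \<le> k" for l y
    using that by (induction l) (auto split: option.split)
  have cur_eq: "current k (restrict y {..<k}) = current k y" for y
    by (simp add: current_def restrict_state)
  have "current k \<in> obs_space k \<rightarrow>\<^sub>M states M"
    and "Measurable.pred (obs_space k) (\<lambda>y. state_at M \<pi> \<phi> k y \<noteq> None)"
    using Suc by auto
  from this(2) measurable_compose[OF restrict this(1)]
    measurable_compose[OF restrict, of "\<lambda>y. state_at M \<pi> \<phi> k y \<noteq> None" "count_space UNIV"]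
  have cur: "current k \<in> ?P \<rightarrow>\<^sub>M states M"
    and alive: "Measurable.pred ?P (\<lambda>y. state_at M \<pi> \<phi> k y \<noteq> None)"
    by (simp_all add: cur_eq restrict_state)
  have k: "k < horizon M"
    using Suc.prems by simp
  have "Measurable.pred ?P (\<lambda>y. \<phi> k (current k y))"
    by (rule measurable_compose[OF cur stop_measurable[OF k]])
  with alive have cont: "Measurable.pred ?P (continues k)"
    unfolding continues_def[abs_def] by simp
  have "(\<lambda>y. y k) \<in> ?P \<rightarrow>\<^sub>M borel"
    by (rule measurable_component_singleton) simp
  then have "(\<lambda>y. evolve M k (current k y) (\<pi> k (current k y)) (y k)) \<in> ?P \<rightarrow>\<^sub>M states M"
    by (intro evolve_measurable[OF k] cur measurable_compose[OF cur policy_measurable[OF k]])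
  then have "(\<lambda>y. if continues k y then evolve M k (current k y) (\<pi> k (current k y)) (y k) else init M)
      \<in> ?P \<rightarrow>\<^sub>M states M"
    using cont init_space by (intro measurable_If) (auto simp: pred_def)
  moreover have "current (Suc k) y
      = (if continues k y then evolve M k (current k y) (\<pi> k (current k y)) (y k) else init M)" for y
    by (auto simp: current_def continues_def split: option.splits)
  ultimately have "current (Suc k) \<in> ?P \<rightarrow>\<^sub>M states M"
    by presburger
  moreover have "state_at M \<pi> \<phi> (Suc k) y \<noteq> None \<longleftrightarrow> continues k y" for y
    by (auto simp: current_def continues_def split: option.splits)
  ultimately show ?case
    using cont by simp
qed

lemma obs_kernel_eq:
  "obs_kernel M \<pi> \<phi> k y =
    (if continues k y then predictive M k (current k y) (\<pi> k (current k y)) else return borel 0)"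
  by (auto simp: obs_kernel_def continues_def current_def split: option.splits)

lemma continues_measurable:
  assumes "k < horizon M"
  shows "Measurable.pred (obs_space k) (continues k)"
proof -
  have "Measurable.pred (obs_space k) (\<lambda>y. \<phi> k (current k y))"
    using current_measurable[of k] assms
    by (intro measurable_compose[OF _ stop_measurable[OF assms]]) auto
  with conjunct1[OF current_measurable[OF less_imp_le[OF assms]]] show ?thesis
    unfolding continues_def[abs_def] by simp
qed

lemma obs_kernel_measurable:
  assumes k: "k < horizon M"
  shows "obs_kernel M \<pi> \<phi> k \<in> obs_space k \<rightarrow>\<^sub>M subprob_algebra borel"
proof -
  have cur: "current k \<in> obs_space k \<rightarrow>\<^sub>M states M"
    using current_measurable[of k] k by simp
  have "(\<lambda>y. predictive M k (current k y) (\<pi> k (current k y))) \<in> obs_space k \<rightarrow>\<^sub>M subprob_algebra borel"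
    by (intro predictive_kernel[OF k] cur measurable_compose[OF cur policy_measurable[OF k]])
  moreover have "(\<lambda>y. return borel (0 :: real ^ 'n)) \<in> obs_space k \<rightarrow>\<^sub>M subprob_algebra borel"
    by (intro measurable_const measurable_space[OF return_measurable]) simp
  ultimately show ?thesis
    unfolding obs_kernel_eq[abs_def]
    using continues_measurable[OF k] by (intro measurable_If) (auto simp: pred_def)
qed

lemma obs_kernel_prob:
  assumes k: "k < horizon M"
  shows "prob_space (obs_kernel M \<pi> \<phi> k y)"
proof (cases "continues k y")
  case True
  then have "current k y \<in> space (states M)"
    using state_at_space[of k y] k by (auto simp: continues_def current_def)
  with True show ?thesis
    using k by (simp add: obs_kernel_eq predictive_prob policy_design)
next
  case False
  then show ?thesis
    by (simp add: obs_kernel_eq prob_space_return)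
qed

lemma sets_obs_kernel [simp]: "sets (obs_kernel M \<pi> \<phi> k y) = sets borel"
  by (simp add: obs_kernel_eq)

text \<open>Names the kernel inside the recursion of \<open>obs_law\<close>, so that the results on
  compositions of kernels can be applied to it.\<close>

definition step_kernel :: "nat \<Rightarrow> (nat \<Rightarrow> real ^ 'n) \<Rightarrow> (nat \<Rightarrow> real ^ 'n) measure" where
  "step_kernel k y = distr (obs_kernel M \<pi> \<phi> k y) (obs_space (Suc k)) (\<lambda>z. y(k := z))"

lemma obs_law_Suc_eq: "obs_law M \<pi> \<phi> (Suc k) = obs_law M \<pi> \<phi> k \<bind> step_kernel k"
  by (simp add: step_kernel_def[abs_def])

declare obs_law.simps(2) [simp del]

lemma fun_upd_measurable:
  "(\<lambda>(y, z). y(k := z)) \<in> obs_space k \<Otimes>\<^sub>M borel \<rightarrow>\<^sub>M obs_space (Suc k)"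
proof -
  have "(\<lambda>x. (fst x)(k := snd x)) \<in> obs_space k \<Otimes>\<^sub>M borel \<rightarrow>\<^sub>M obs_space (Suc k)"
    by (rule measurable_fun_upd_coordinate) (simp_all add: lessThan_Suc)
  then show ?thesis
    by (simp add: case_prod_beta')
qed

lemma fun_upd_measurable_right:
  assumes "y \<in> space (obs_space k)"
  shows "(\<lambda>z. y(k := z)) \<in> borel \<rightarrow>\<^sub>M obs_space (Suc k)"
  using measurable_compose[OF measurable_Pair1'[OF assms] fun_upd_measurable[of k]] by simp

lemma step_kernel_measurable:
  assumes k: "k < horizon M"
  shows "step_kernel k \<in> obs_space k \<rightarrow>\<^sub>M subprob_algebra (obs_space (Suc k))"
  unfolding step_kernel_def[abs_def]
  by (rule measurable_distr2[OF fun_upd_measurable obs_kernel_measurable[OF k]])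

text \<open>The two claims are proved together: \<open>step_kernel\<close> is a kernel on the
  stage-\<open>k\<close> law only once the sigma-algebra of that law is known.\<close>

lemma obs_law_prob_sets:
  assumes "k \<le> horizon M"
  shows "prob_space (obs_law M \<pi> \<phi> k) \<and> sets (obs_law M \<pi> \<phi> k) = sets (obs_space k)"
  using assms
proof (induction k)
  case 0
  then show ?case
    by (auto intro!: prob_space_return simp: space_PiM)
next
  case (Suc k)
  then have k: "k < horizon M" and prob: "prob_space (obs_law M \<pi> \<phi> k)"
    and sets: "sets (obs_law M \<pi> \<phi> k) = sets (obs_space k)"
    by auto
  note space = sets_eq_imp_space_eq[OF sets]
  have ker: "step_kernel k \<in> obs_law M \<pi> \<phi> k \<rightarrow>\<^sub>M subprob_algebra (obs_space (Suc k))"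
    using step_kernel_measurable[OF k] by (simp add: measurable_cong_sets[OF sets refl])
  have "prob_space (step_kernel k y)" if "y \<in> space (obs_law M \<pi> \<phi> k)" for y
    unfolding step_kernel_def
    using fun_upd_measurable_right[of y k] that
    by (intro prob_space.prob_space_distr obs_kernel_prob k)
      (simp add: space measurable_cong_sets[OF sets_obs_kernel refl])
  then have "prob_space (obs_law M \<pi> \<phi> k \<bind> step_kernel k)"
    by (intro prob_space.prob_space_bind[OF prob _ ker]) auto
  moreover have "sets (obs_law M \<pi> \<phi> k \<bind> step_kernel k) = sets (obs_space (Suc k))"
    using prob_space.not_empty[OF prob] by (intro sets_bind) (simp_all add: step_kernel_def)
  ultimately show ?case
    by (simp add: obs_law_Suc_eq)
qed

lemma sets_obs_law: "k \<le> horizon M \<Longrightarrow> sets (obs_law M \<pi> \<phi> k) = sets (obs_space k)"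
  using obs_law_prob_sets by blast

lemma space_obs_law: "k \<le> horizon M \<Longrightarrow> space (obs_law M \<pi> \<phi> k) = space (obs_space k)"
  by (rule sets_eq_imp_space_eq[OF sets_obs_law])

lemma step_kernel_obs_law_measurable:
  assumes "k < horizon M"
  shows "step_kernel k \<in> obs_law M \<pi> \<phi> k \<rightarrow>\<^sub>M subprob_algebra (obs_space (Suc k))"
  using step_kernel_measurable[OF assms]
  by (simp only: measurable_cong_sets[OF sets_obs_law[OF less_imp_le[OF assms]] refl])

lemma obs_law_nonempty: "k \<le> horizon M \<Longrightarrow> space (obs_law M \<pi> \<phi> k) \<noteq> {}"
  using prob_space.not_empty obs_law_prob_sets by blast

lemma fun_upd_obs_kernel_measurable:
  assumes "k \<le> horizon M" and "y \<in> space (obs_law M \<pi> \<phi> k)"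
  shows "(\<lambda>z. y(k := z)) \<in> obs_kernel M \<pi> \<phi> k y \<rightarrow>\<^sub>M obs_space (Suc k)"
  using fun_upd_measurable_right[of y k] assms
  by (simp add: space_obs_law measurable_cong_sets[OF sets_obs_kernel refl])

lemma AE_obs_law_SucD:
  assumes k: "k < horizon M" and P: "AE y in obs_law M \<pi> \<phi> (Suc k). P y"
  shows "AE y in obs_law M \<pi> \<phi> k. AE z in obs_kernel M \<pi> \<phi> k y. P (y(k := z))"
proof -
  have "AE y in obs_law M \<pi> \<phi> k. AE x in step_kernel k y. P x"
    using P k unfolding obs_law_Suc_eq
    by (intro AE_bind_imp[OF step_kernel_obs_law_measurable obs_law_nonempty]) auto
  then show ?thesis
    using AE_space
  proof eventually_elim
    case (elim y)
    show ?case
      by (rule AE_distrD[OF fun_upd_obs_kernel_measurable elim(1)[unfolded step_kernel_def]])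
        (use k elim(2) in auto)
  qed
qed

text \<open>Conditioning on the first \<open>k\<close> observations. Since
  \<open>step_kernel\<close> is the image of \<open>obs_kernel\<close> under insertion of the new
  coordinate, its integrals become integrals over the next observation alone.\<close>

lemma
  fixes f :: "(nat \<Rightarrow> real ^ 'n) \<Rightarrow> 'e::euclidean_space"
  assumes k: "k < horizon M" and f: "integrable (obs_law M \<pi> \<phi> (Suc k)) f"
  shows integrable_obs_law_SucD:
      "integrable (obs_law M \<pi> \<phi> k) (\<lambda>y. LINT z|obs_kernel M \<pi> \<phi> k y. f (y(k := z)))" (is ?A)
    and integral_obs_law_Suc:
      "(LINT y|obs_law M \<pi> \<phi> (Suc k). f y)
        = (LINT y|obs_law M \<pi> \<phi> k. LINT z|obs_kernel M \<pi> \<phi> k y. f (y(k := z)))" (is ?B)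
proof -
  note ker = step_kernel_obs_law_measurable[OF k] obs_law_nonempty[OF less_imp_le[OF k]]
  have f': "integrable (obs_law M \<pi> \<phi> k \<bind> step_kernel k) f"
    using f by (simp add: obs_law_Suc_eq)
  have "f \<in> borel_measurable (obs_space (Suc k))"
    using borel_measurable_integrable[OF f]
    by (simp only: measurable_cong_sets[OF sets_obs_law[OF Suc_leI[OF k]] refl])
  then have eq: "(LINT x|step_kernel k y. f x) = (LINT z|obs_kernel M \<pi> \<phi> k y. f (y(k := z)))"
    if "y \<in> space (obs_law M \<pi> \<phi> k)" for y
    unfolding step_kernel_def using that k
    by (intro integral_distr fun_upd_obs_kernel_measurable) auto
  show ?A
    using integrable_bind_inner[OF ker f'] by (simp add: eq cong: Bochner_Integration.integrable_cong)
  show ?B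
    using integral_bind_euclidean[OF ker f']
    by (simp add: obs_law_Suc_eq eq cong: Bochner_Integration.integral_cong)
qed

text \<open>Integrating out a later observation changes nothing, as every kernel has mass one.
  Dependence on the past alone is phrased as invariance under updates because
  \<open>obs_space j\<close> and \<open>obs_space k\<close> consist of extensional functions on
  different index sets.\<close>

lemma
  fixes f :: "(nat \<Rightarrow> real ^ 'n) \<Rightarrow> 'e::euclidean_space"
  assumes k: "k \<le> j" "j \<le> horizon M" and f: "integrable (obs_law M \<pi> \<phi> j) f"
    and past: "\<And>i y z. k \<le> i \<Longrightarrow> f (y(i := z)) = f y"
  shows integrable_obs_law_marginal: "integrable (obs_law M \<pi> \<phi> k) f"
    and integral_obs_law_marginal: "(LINT y|obs_law M \<pi> \<phi> j. f y) = (LINT y|obs_law M \<pi> \<phi> k. f y)"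
proof -
  have "integrable (obs_law M \<pi> \<phi> j) f \<longrightarrow> integrable (obs_law M \<pi> \<phi> k) f
      \<and> (LINT y|obs_law M \<pi> \<phi> j. f y) = (LINT y|obs_law M \<pi> \<phi> k. f y)"
    using k
  proof (induction rule: dec_induct)
    case (step i)
    then have i: "i < horizon M"
      by simp
    have "(LINT z|obs_kernel M \<pi> \<phi> i y. f (y(i := z))) = f y" for y
      using prob_space.prob_space[OF obs_kernel_prob[OF i], of y] step(1) by (simp add: past)
    with step integrable_obs_law_SucD[OF i, of f] integral_obs_law_Suc[OF i, of f] show ?case
      by simp
  qed simp
  with f show "integrable (obs_law M \<pi> \<phi> k) f"
    and "(LINT y|obs_law M \<pi> \<phi> j. f y) = (LINT y|obs_law M \<pi> \<phi> k. f y)"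
    by auto
qed

lemma AE_obs_law_marginal:
  assumes k: "k \<le> j" "j \<le> horizon M" and P: "AE y in obs_law M \<pi> \<phi> j. P y"
    and past: "\<And>i y z. k \<le> i \<Longrightarrow> P (y(i := z)) = P y"
  shows "AE y in obs_law M \<pi> \<phi> k. P y"
proof -
  have "(AE y in obs_law M \<pi> \<phi> j. P y) \<longrightarrow> (AE y in obs_law M \<pi> \<phi> k. P y)"
    using k
  proof (induction rule: dec_induct)
    case (step i)
    then have i: "i < horizon M"
      by simp
    have const: "(AE z in obs_kernel M \<pi> \<phi> i y. P y) \<longleftrightarrow> P y" for y
      using prob_space.AE_const[OF obs_kernel_prob[OF i]] .
    show ?case
      using step AE_obs_law_SucD[OF i, of P] by (auto simp: past const)
  qed simp
  with P show ?thesis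
    by simp
qed

text \<open>The dynamic programming martingale of a fixed policy: rewards collected before stage
  \<open>k\<close> plus the value to go. It is deterministic at stage 0 and equals the total reward
  at the horizon.\<close>

definition value_process :: "nat \<Rightarrow> (nat \<Rightarrow> real ^ 'n) \<Rightarrow> real" where
  "value_process k y =
    (\<Sum>l<k. stage_reward M \<pi> \<phi> l (state_at M \<pi> \<phi> l y) (y l)
            + terminal_reward M \<phi> l (state_at M \<pi> \<phi> l y))
    + (case state_at M \<pi> \<phi> k y of None \<Rightarrow> 0 | Some s \<Rightarrow> stage_value M \<pi> \<phi> k s)"

text \<open>After stopping nothing changes; when stopping occurs at stage \<open>k\<close>, the
  stopping reward moves from the value to go into the sum; otherwise the identity is the definition
  of the backup, and \<open>wd\<close> lets the collected rewards be split off the integral.\<close>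

lemma value_process_martingale:
  assumes k: "k < horizon M"
    and wd: "\<And>s \<xi>. s \<in> space (states M) \<Longrightarrow> \<xi> \<in> designs M k \<Longrightarrow>
      integrable (predictive M k s \<xi>)
        (\<lambda>y. cont_reward M k s \<xi> y + stage_value M \<pi> \<phi> (Suc k) (evolve M k s \<xi> y))"
  shows "(LINT z|obs_kernel M \<pi> \<phi> k y. value_process (Suc k) (y(k := z))) = value_process k y"
proof -
  interpret K: prob_space "obs_kernel M \<pi> \<phi> k y"
    by (rule obs_kernel_prob[OF k])
  define c where "c = (\<Sum>l<k. stage_reward M \<pi> \<phi> l (state_at M \<pi> \<phi> l y) (y l)
            + terminal_reward M \<phi> l (state_at M \<pi> \<phi> l y))"
  have next_eq: "value_process (Suc k) (y(k := z)) = c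
      + stage_reward M \<pi> \<phi> k (state_at M \<pi> \<phi> k y) z + terminal_reward M \<phi> k (state_at M \<pi> \<phi> k y)
      + (case state_at M \<pi> \<phi> (Suc k) (y(k := z)) of None \<Rightarrow> 0 | Some s \<Rightarrow> stage_value M \<pi> \<phi> (Suc k) s)" for z
    by (simp add: value_process_def c_def state_at_fun_upd del: state_at.simps)
  consider (stopped) "state_at M \<pi> \<phi> k y = None"
    | (stop) s where "state_at M \<pi> \<phi> k y = Some s" "\<phi> k s"
    | (cont) s where "state_at M \<pi> \<phi> k y = Some s" "\<not> \<phi> k s"
    by (cases "state_at M \<pi> \<phi> k y") auto
  then show ?thesis
  proof cases
    case stopped
    then have "value_process (Suc k) (y(k := z)) = value_process k y" for z
      unfolding next_eq
      by (simp add: state_at_fun_upd stage_reward_def terminal_reward_def value_process_def c_def)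
    then show ?thesis
      using K.prob_space by simp
  next
    case (stop s)
    then have "value_process (Suc k) (y(k := z)) = value_process k y" for z
      unfolding next_eq using k
      by (simp add: state_at_fun_upd stage_reward_def terminal_reward_def value_process_def c_def
          stage_value.simps[of M \<pi> \<phi> k])
    then show ?thesis
      using K.prob_space by simp
  next
    case (cont s)
    have s: "s \<in> space (states M)"
      using state_at_space[OF _ cont(1)] k by simp
    have pred: "obs_kernel M \<pi> \<phi> k y = predictive M k s (\<pi> k s)"
      using cont by (simp add: obs_kernel_def)
    have "value_process (Suc k) (y(k := z)) = c + (cont_reward M k s (\<pi> k s) z
        + stage_value M \<pi> \<phi> (Suc k) (evolve M k s (\<pi> k s) z))" for z
      unfolding next_eq using k cont
      by (simp add: state_at_fun_upd stage_reward_def terminal_reward_def)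
    moreover have "value_process k y = c + backup M k (stage_value M \<pi> \<phi> (Suc k)) s (\<pi> k s)"
      using cont k by (simp add: value_process_def c_def stage_value.simps[of M \<pi> \<phi> k])
    ultimately show ?thesis
      using Bochner_Integration.integral_add[OF K.integrable_const wd[OF s policy_design[OF k s], folded pred], of c]
        K.prob_space by (simp add: pred backup_def)
  qed
qed

text \<open>The expectation of the martingale is constant. The induction starts at the horizon,
  where integrability is assumed, and conditioning passes integrability down to earlier
  stages.\<close>

lemma expected_utility_eq_stage_value:
  assumes total: "integrable (trajectory_law M \<pi> \<phi>) (total_reward M \<pi> \<phi>)"
    and wd: "\<And>k s \<xi>. k < horizon M \<Longrightarrow> s \<in> space (states M) \<Longrightarrow> \<xi> \<in> designs M k \<Longrightarrow>
      integrable (predictive M k s \<xi>)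
        (\<lambda>y. cont_reward M k s \<xi> y + stage_value M \<pi> \<phi> (Suc k) (evolve M k s \<xi> y))"
  shows "expected_utility M \<pi> \<phi> = stage_value M \<pi> \<phi> 0 (init M)"
proof -
  have last: "value_process (horizon M) = total_reward M \<pi> \<phi>"
    by (auto simp: fun_eq_iff value_process_def total_reward_def stage_value.simps[of M \<pi> \<phi> "horizon M"]
        terminal_reward_def split: option.split)
  have "integrable (obs_law M \<pi> \<phi> 0) (value_process 0)
      \<and> (LINT y|obs_law M \<pi> \<phi> 0. value_process 0 y) = expected_utility M \<pi> \<phi>"
    using le0[of "horizon M"]
  proof (induction rule: inc_induct)
    case base
    then show ?case
      using total by (simp add: last expected_utility_def)
  next
    case (step k)
    then have "integrable (obs_law M \<pi> \<phi> (Suc k)) (value_process (Suc k))"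
      by simp
    from integrable_obs_law_SucD[OF step(2) this] integral_obs_law_Suc[OF step(2) this] step show ?case
      by (simp add: value_process_martingale wd)
  qed
  moreover have "value_process 0 y = stage_value M \<pi> \<phi> 0 (init M)" for y
    by (simp add: value_process_def)
  ultimately show ?thesis
    using prob_space.prob_space[of "obs_law M \<pi> \<phi> 0"] obs_law_prob_sets[of 0] by simp
qed

end

section \<open>The gradient recursion\<close>

text \<open>The rule stops exactly when the stopping reward is at least the continuation value. As a
  maximum, the value no longer mentions a stopping set that moves with the parameters.\<close>

lemma stage_value_induced_stop:
  assumes "k < horizon M"
  shows "stage_value M \<pi> (induced_stop M \<pi>) k s
    = max (stop_reward M s) (cont_value M \<pi> (induced_stop M \<pi>) k s (\<pi> k s))"
  using assms by (simp add: stage_value.simps[of M \<pi> _ k] induced_stop_iff cont_value_def)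

lemma stage_value_horizon: "stage_value M \<pi> \<phi> (horizon M) s = stop_reward M s"
  by (simp add: stage_value.simps[of M \<pi> \<phi> "horizon M"] terminal_reward_def)

lemma state_at_eq_None_iff:
  "state_at M \<pi> \<phi> k y = None \<longleftrightarrow> (\<exists>j<k. \<exists>s. state_at M \<pi> \<phi> j y = Some s \<and> \<phi> j s)"
proof (induction k)
  case (Suc k)
  have "state_at M \<pi> \<phi> (Suc k) y = None
      \<longleftrightarrow> state_at M \<pi> \<phi> k y = None \<or> (\<exists>s. state_at M \<pi> \<phi> k y = Some s \<and> \<phi> k s)"
    by (auto split: option.split)
  then show ?case
    unfolding Suc.IH by (auto simp: less_Suc_eq)
qed simp

text \<open>Not having stopped before stage \<open>k\<close> means that the stage-\<open>k\<close>
  state is nonterminal, so the indicator in the gradient formula is decided by this state.\<close>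

lemma less_stopping_time_iff:
  assumes "k < horizon M"
  shows "k < stopping_time M \<pi> \<phi> y \<longleftrightarrow> (\<exists>s. state_at M \<pi> \<phi> k y = Some s \<and> \<not> \<phi> k s)"
proof -
  have "k < stopping_time M \<pi> \<phi> y
      \<longleftrightarrow> (\<forall>j\<le>k. \<not> (\<exists>s. state_at M \<pi> \<phi> j y = Some s \<and> \<phi> j s))"
    using assms unfolding stopping_time_def
    by (subst Min_gr_iff) (auto simp: not_le, meson dual_order.strict_trans2 leD)
  also have "\<dots> \<longleftrightarrow> state_at M \<pi> \<phi> k y \<noteq> None \<and> (\<nexists>s. state_at M \<pi> \<phi> k y = Some s \<and> \<phi> k s)"
    unfolding state_at_eq_None_iff by (auto simp: le_less)
  finally show ?thesis
    by auto
qed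

context oed_setting
begin

lemma cont_value_cong_stage_value:
  assumes "k < horizon M" and "s \<in> space (states M)" and "\<xi> \<in> designs M k"
    and "\<And>s'. s' \<in> space (states M) \<Longrightarrow> stage_value M \<pi> \<phi> (Suc k) s' = stage_value M \<pi>' \<phi>' (Suc k) s'"
  shows "cont_value M \<pi> \<phi> k s \<xi> = cont_value M \<pi>' \<phi>' k s \<xi>"
  using assms by (simp add: cont_value_def backup_def evolve_space)

text \<open>In the maximum form only the design maps from stage \<open>k\<close> on enter. Agreement
  is asked on the state space alone, since \<open>parameterized_policy\<close> controls the maps
  only there; \<open>evolve\<close> does not leave it.\<close>

lemma stage_value_induced_stop_cong:
  assumes "k \<le> horizon M"
    and "\<And>l s. k \<le> l \<Longrightarrow> l < horizon M \<Longrightarrow> s \<in> space (states M) \<Longrightarrow> \<pi> l s \<in> designs M l"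
    and "\<And>l s. k \<le> l \<Longrightarrow> l < horizon M \<Longrightarrow> s \<in> space (states M) \<Longrightarrow> \<pi>' l s = \<pi> l s"
    and "s \<in> space (states M)"
  shows "stage_value M \<pi>' (induced_stop M \<pi>') k s = stage_value M \<pi> (induced_stop M \<pi>) k s"
  using assms
proof (induction arbitrary: s rule: inc_induct)
  case base
  then show ?case
    by (simp add: stage_value_horizon)
next
  case (step k)
  have "cont_value M \<pi>' (induced_stop M \<pi>') k s (\<pi> k s) = cont_value M \<pi> (induced_stop M \<pi>) k s (\<pi> k s)"
    using step by (intro cont_value_cong_stage_value) auto
  with step show ?case
    by (simp add: stage_value_induced_stop)
qed

end

section \<open>Variation of a single parameter block\<close>

locale oed_parameterized = oed_setting M
  for M :: "('s, 'p::finite, 'd::finite, 'n::finite) oed" +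
  fixes blk :: "'m::finite \<Rightarrow> nat" and \<mu> :: "real ^ 'm \<Rightarrow> ('s, 'd) design_policy"
  assumes policy: "parameterized_policy M blk \<mu>"
begin

lemma policy_w: "oed_policy M (\<mu> w)"
  using policy by unfold_locales (auto simp: parameterized_policy_def)

lemma process_w: "oed_process M (\<mu> w) (induced_stop M (\<mu> w))"
proof -
  interpret oed_policy M "\<mu> w"
    by (rule policy_w)
  show ?thesis
    by unfold_locales (rule induced_stop_measurable)
qed

lemma policy_w_design: "k < horizon M \<Longrightarrow> s \<in> space (states M) \<Longrightarrow> \<mu> w k s \<in> designs M k"
  by (rule oed_policy.policy_design[OF policy_w])

lemma policy_w_cong:
  assumes "k < horizon M" and "s \<in> space (states M)" and "\<And>i. blk i = k \<Longrightarrow> w' $ i = w $ i"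
  shows "\<mu> w' k s = \<mu> w k s"
  using policy assms by (auto simp: parameterized_policy_def)

text \<open>With its design argument given, the stage-\<open>k\<close> continuation value consults
  only later design maps, and these do not see block \<open>k\<close>.\<close>

lemma cont_value_w_cong:
  assumes "k < horizon M" and "s \<in> space (states M)" and "\<xi> \<in> designs M k"
    and eq: "\<And>i. blk i \<noteq> k \<Longrightarrow> w' $ i = w $ i"
  shows "cont_value_w M \<mu> w' k s \<xi> = cont_value_w M \<mu> w k s \<xi>"
proof (rule cont_value_cong_stage_value[OF assms(1-3)])
  fix s' assume "s' \<in> space (states M)"
  then show "value_w M \<mu> w' (Suc k) s' = value_w M \<mu> w (Suc k) s'"
    using assms by (intro stage_value_induced_stop_cong policy_w_design policy_w_cong) auto
qed

text \<open>
  Moving only one block of \<open>w\<close> changes either the stage-\<open>k\<close> design or the later policies, never both.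
  Hence along each block the value at the moving design splits into a sum of two functions, in one of
  which the design is frozen and in the other the later policies are.
\<close>

lemma has_gradient_cont_value_policy:
  assumes k: "k < horizon M" and s: "s \<in> space (states M)"
    and \<mu>: "(\<lambda>w'. \<mu> w' k s) differentiable (at w)"
    and Q: "cont_value_w M \<mu> w k s differentiable (at (\<mu> w k s) within designs M k)"
    and q: "has_gradient blk (\<lambda>w'. cont_value_w M \<mu> w' k s (\<mu> w k s)) q w"
  shows "has_gradient blk (\<lambda>w'. cont_value_w M \<mu> w' k s (\<mu> w' k s))
    (q + transpose (jacobian (\<lambda>w'. \<mu> w' k s) (at w)) *v
         design_gradient (cont_value_w M \<mu> w k s) (at (\<mu> w k s) within designs M k)) w"
proof -
  let ?Q = "\<lambda>w' \<xi>. cont_value_w M \<mu> w' k s \<xi>"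
  have range: "range (\<lambda>w'. \<mu> w' k s) \<subseteq> designs M k"
    using policy_w_design[OF k s] by auto
  \<comment> \<open>The constant cancels the base value that the sum of the two partly frozen
    functions counts twice.\<close>
  have "has_gradient blk (\<lambda>w'. - ?Q w (\<mu> w k s) + (?Q w' (\<mu> w k s) + ?Q w (\<mu> w' k s)))
    (q + transpose (jacobian (\<lambda>w'. \<mu> w' k s) (at w)) *v
         design_gradient (?Q w) (at (\<mu> w k s) within designs M k)) w"
    unfolding has_gradient_add_const_iff
    using has_gradient_compose_design[OF \<mu> range Q] by (intro has_gradient_add q)
  then show ?thesis
  proof (rule has_gradient_cong_block)
    fix l w' assume eq: "\<And>i. blk i \<noteq> l \<Longrightarrow> w' $ i = w $ i"
    show "?Q w' (\<mu> w' k s) = - ?Q w (\<mu> w k s) + (?Q w' (\<mu> w k s) + ?Q w (\<mu> w' k s))"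
    proof (cases "l = k")
      case True
      then have "?Q w' \<xi> = ?Q w \<xi>" if "\<xi> \<in> designs M k" for \<xi>
        using that eq by (intro cont_value_w_cong k s) auto
      then show ?thesis
        by (simp add: policy_w_design k s)
    next
      case False
      then have "\<mu> w' k s = \<mu> w k s"
        using eq by (intro policy_w_cong k s) auto
      then show ?thesis
        by simp
    qed
  qed
qed

text \<open>Off the boundary the weak inequality of the stopping rule agrees with the strict one in
  \<open>has_gradient_max_const\<close>, so the rule selects the branch of the maximum that is
  active near \<open>w\<close>.\<close>

lemma has_gradient_value:
  assumes k: "k < horizon M"
    and q: "has_gradient blk (\<lambda>w'. cont_value_w M \<mu> w' k s (\<mu> w' k s)) q w"
    and off: "\<not> on_stopping_boundary M \<mu> w k s"
  shows "has_gradient blk (\<lambda>w'. value_w M \<mu> w' k s) (if induced_stop M (\<mu> w) k s then 0 else q) w"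
proof -
  have "cont_value_w M \<mu> w k s (\<mu> w k s) \<noteq> stop_reward M s"
    using off by (simp add: on_stopping_boundary_def)
  with has_gradient_max_const[OF q this] show ?thesis
    by (simp add: stage_value_induced_stop[OF k] induced_stop_iff[OF k] le_less)
qed

end

theorem theorem3p3:
  fixes M :: "('s, 'p::finite, 'd::finite, 'n::finite) oed"
    and \<mu> :: "real ^ 'm::finite \<Rightarrow> ('s, 'd) design_policy"
    and blk :: "'m \<Rightarrow> nat"
    and w :: "real ^ 'm"
  assumes model: "oed_model M"
    and policy: "parameterized_policy M blk \<mu>"
    and utility_wd:
      "\<And>w'. integrable (law_w M \<mu> w') (total_reward M (\<mu> w') (induced_stop M (\<mu> w')))"
    and cont_value_wd:
      "\<And>w' k s \<xi>. k < horizon M \<Longrightarrow> s \<in> space (states M) \<Longrightarrow> \<xi> \<in> designs M k \<Longrightarrow>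
         integrable (predictive M k s \<xi>)
           (\<lambda>y. cont_reward M k s \<xi> y + value_w M \<mu> w' (Suc k) (evolve M k s \<xi> y))"
    and gradient_wd:
      "\<And>k. k < horizon M \<Longrightarrow> integrable (law_w M \<mu> w) (gradient_integrand M \<mu> w k)"
    and policy_differentiable:
      "\<And>k s. k < horizon M \<Longrightarrow> s \<in> space (states M) \<Longrightarrow>
         (\<lambda>w'. \<mu> w' k s) differentiable (at w)"
    and cont_value_differentiable:
      "\<And>k s \<xi>. k < horizon M \<Longrightarrow> s \<in> space (states M) \<Longrightarrow> \<xi> \<in> designs M k \<Longrightarrow>
         cont_value_w M \<mu> w k s differentiable (at \<xi> within designs M k)"
    and boundary_null:
      "AE y in law_w M \<mu> w. \<not> (\<exists>k<horizon M. \<exists>s.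
         state_w M \<mu> w k y = Some s \<and> on_stopping_boundary M \<mu> w k s)"
    and interchange:
      "\<And>k s \<xi>. k < horizon M \<Longrightarrow> s \<in> space (states M) \<Longrightarrow> \<xi> \<in> designs M k \<Longrightarrow>
         derivative_interchange M blk \<mu> w k s \<xi>"
  shows "has_gradient blk
           (\<lambda>w'. expected_utility M (\<mu> w') (induced_stop M (\<mu> w')))
           (\<Sum>k<horizon M. LINT y|law_w M \<mu> w. gradient_integrand M \<mu> w k y)
           w"
proof -
  interpret oed_parameterized M blk \<mu>
    using model policy by unfold_locales
  \<comment> \<open>Trajectories are always drawn under the base parameter \<open>w\<close>; only
    the value functions are varied with \<open>w'\<close>.\<close>
  define \<phi> where "\<phi> = induced_stop M (\<mu> w)"
  interpret P: oed_process M "\<mu> w" \<phi>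
    unfolding \<phi>_def by (rule process_w)
  let ?law = "obs_law M (\<mu> w) \<phi>" and ?kernel = "obs_kernel M (\<mu> w) \<phi>" and ?state = "state_at M (\<mu> w) \<phi>"
  let ?A = "gradient_integrand M \<mu> w"
  \<comment> \<open>After stopping the value to go is 0, so its gradient is required to be 0; this
    keeps the recursion uniform over all trajectories.\<close>
  let ?is_grad = "\<lambda>k y g. case ?state k y of None \<Rightarrow> g = 0
    | Some s \<Rightarrow> has_gradient blk (\<lambda>w'. value_w M \<mu> w' k s) g w"

  have A_stop: "?A k y = 0" if "k < horizon M" and "\<And>s. ?state k y = Some s \<Longrightarrow> \<phi> k s" for k y
    using that by (auto simp: gradient_integrand_def less_stopping_time_iff \<phi>_def)
  have A_cont: "?A k y = transpose (jacobian (\<lambda>w'. \<mu> w' k s) (at w)) *v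
      design_gradient (cont_value_w M \<mu> w k s) (at (\<mu> w k s) within designs M k)"
    if "k < horizon M" and "?state k y = Some s" and "\<not> \<phi> k s" for k y s
    using that by (auto simp: gradient_integrand_def less_stopping_time_iff \<phi>_def)
  \<comment> \<open>The integrand at stage \<open>k\<close> is determined by the first
    \<open>k\<close> observations, although the stopping time itself looks at the whole
    trajectory.\<close>
  have A_past: "?A k (y(i := z)) = ?A k y" if "k < horizon M" and "k \<le> i" for k i y z
    using that P.state_at_fun_upd[of k i y z]
    by (auto simp: gradient_integrand_def less_stopping_time_iff \<phi>_def)

  have off_boundary: "AE y in ?law k. \<forall>s. ?state k y = Some s \<longrightarrow> \<not> on_stopping_boundary M \<mu> w k s"
    if k: "k < horizon M" for k
  proof (rule P.AE_obs_law_marginal[OF less_imp_le[OF k] order_refl])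
    show "AE y in ?law (horizon M). \<forall>s. ?state k y = Some s \<longrightarrow> \<not> on_stopping_boundary M \<mu> w k s"
      using boundary_null unfolding \<phi>_def[symmetric] by eventually_elim (use k in blast)
  qed (simp add: P.state_at_fun_upd)

  \<comment> \<open>At stage \<open>k\<close> of the backward induction, \<open>G\<close> is a
    gradient of the value to go as a function of the first \<open>k\<close> observations, and its
    expectation is the tail of the sum from \<open>k\<close> on. Building \<open>G\<close> by
    conditional expectations, rather than choosing gradients pointwise, keeps it integrable.\<close>
  have "\<exists>G. integrable (?law 0) G \<and> (AE y in ?law 0. ?is_grad 0 y (G y))
      \<and> (LINT y|?law 0. G y) = (\<Sum>l\<in>{0..<horizon M}. LINT y|?law (horizon M). ?A l y)"
    using le0[of "horizon M"]
  proof (induction rule: inc_induct)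
    case base
    show ?case
      \<comment> \<open>At the horizon the value is the stopping reward, which is constant in the
        parameters.\<close>
      by (intro exI[of _ "\<lambda>_. 0"]) (auto simp: stage_value_horizon has_gradient_def split: option.split)
  next
    case (step k)
    then have k: "k < horizon M"
      by simp
    from step obtain G where G: "integrable (?law (Suc k)) G"
      and G_grad: "AE y in ?law (Suc k). ?is_grad (Suc k) y (G y)"
      and G_int: "(LINT y|?law (Suc k). G y) = (\<Sum>l\<in>{Suc k..<horizon M}. LINT y|?law (horizon M). ?A l y)"
      by blast
    \<comment> \<open>\<open>K\<close> is the conditional expectation of the next gradient given the
      first \<open>k\<close> observations.\<close>
    define K where "K y = (LINT z|?kernel k y. G (y(k := z)))" for y
    have K: "integrable (?law k) K" "(LINT y|?law k. K y) = (LINT y|?law (Suc k). G y)"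
      using P.integrable_obs_law_SucD[OF k G] P.integral_obs_law_Suc[OF k G] by (simp_all add: K_def[abs_def])
    have A: "integrable (?law (horizon M)) (?A k)"
      using gradient_wd[OF k] by (simp add: \<phi>_def)
    note A_marginal = P.integrable_obs_law_marginal[OF less_imp_le[OF k] order_refl A A_past[OF k]]
      P.integral_obs_law_marginal[OF less_imp_le[OF k] order_refl A A_past[OF k]]
    have "AE y in ?law k. ?is_grad k y (K y + ?A k y)"
      using P.AE_obs_law_SucD[OF k G_grad] off_boundary[OF k] AE_space
    proof eventually_elim
      case (elim y)
      consider (stopped) "?state k y = None"
        | (stop) s where "?state k y = Some s" "\<phi> k s"
        | (cont) s where "?state k y = Some s" "\<not> \<phi> k s"
        by (cases "?state k y") auto
      then show ?case
      proof cases
        case stopped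
        with elim(1) have "AE z in ?kernel k y. G (y(k := z)) = 0"
          by (simp add: P.state_at_fun_upd)
        then have "K y = 0"
          unfolding K_def by (rule integral_eq_zero_AE)
        with stopped A_stop[OF k, of y] show ?thesis
          by simp
      next
        case (stop s)
        with elim(1) have "AE z in ?kernel k y. G (y(k := z)) = 0"
          by (simp add: P.state_at_fun_upd)
        then have "K y = 0"
          unfolding K_def by (rule integral_eq_zero_AE)
        moreover have s: "s \<in> space (states M)"
          using P.state_at_space[OF _ stop(1)] k by simp
        \<comment> \<open>A gradient of the continuation value is needed at a stopping state too: it
          provides the continuity that keeps the state inside the stopping region for nearby
          parameters. The unconditional half of \<open>derivative_interchange\<close> supplies
          it.\<close>
        obtain q where "has_gradient blk (\<lambda>w'. cont_value_w M \<mu> w' k s (\<mu> w k s)) q w"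
          using interchange[OF k s policy_w_design[OF k s]] by (auto simp: derivative_interchange_def Let_def)
        from has_gradient_value[OF k has_gradient_cont_value_policy[OF k s policy_differentiable[OF k s]
              cont_value_differentiable[OF k s policy_w_design[OF k s]] this]]
        have "has_gradient blk (\<lambda>w'. value_w M \<mu> w' k s) 0 w"
          using elim(2) stop by (simp add: \<phi>_def)
        ultimately show ?thesis
          using stop A_stop[OF k, of y] by simp
      next
        case (cont s)
        have s: "s \<in> space (states M)"
          using P.state_at_space[OF _ cont(1)] k by simp
        let ?\<xi> = "\<mu> w k s"
        have kernel: "?kernel k y = predictive M k s ?\<xi>"
          using cont by (simp add: obs_kernel_def)
        let ?I = "\<lambda>z w'. cont_reward M k s ?\<xi> z + value_w M \<mu> w' (Suc k) (evolve M k s ?\<xi> z)"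
        have I_grad: "AE z in predictive M k s ?\<xi>. has_gradient blk (?I z) (G (y(k := z))) w"
          using elim(1)[unfolded kernel] cont
          by (simp add: P.state_at_fun_upd has_gradient_add_const_iff)
        \<comment> \<open>The induction hypothesis thus meets the premise of the conditional half of
          \<open>derivative_interchange\<close>.\<close>
        then have "AE z in predictive M k s ?\<xi>. \<exists>g. has_gradient blk (?I z) g w"
          by eventually_elim blast
        with interchange[OF k s policy_w_design[OF k s]] obtain g
          where g: "integrable (predictive M k s ?\<xi>) g"
            and g_grad: "AE z in predictive M k s ?\<xi>. has_gradient blk (?I z) (g z) w"
            and Q_grad: "has_gradient blk (\<lambda>w'. cont_value_w M \<mu> w' k s ?\<xi>) (LINT z|predictive M k s ?\<xi>. g z) w"
          by (auto simp: derivative_interchange_def Let_def)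
        have "G \<in> borel_measurable (P.obs_space (Suc k))"
          using borel_measurable_integrable[OF G]
          by (simp only: measurable_cong_sets[OF P.sets_obs_law[OF Suc_leI[OF k]] refl])
        from measurable_compose[OF P.fun_upd_obs_kernel_measurable[OF less_imp_le[OF k] elim(3)] this]
        have "(\<lambda>z. G (y(k := z))) \<in> borel_measurable (predictive M k s ?\<xi>)"
          by (simp add: kernel)
        \<comment> \<open>The interchange hypothesis brings its own gradients \<open>g\<close>;
          uniqueness identifies them with \<open>G\<close>, so that their integral is
          \<open>K y\<close>.\<close>
        moreover have "AE z in predictive M k s ?\<xi>. G (y(k := z)) = g z"
          using I_grad g_grad by eventually_elim (rule has_gradient_unique)
        ultimately have "K y = (LINT z|predictive M k s ?\<xi>. g z)"
          unfolding K_def kernel using g by (intro integral_cong_AE) auto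
        with Q_grad have "has_gradient blk (\<lambda>w'. cont_value_w M \<mu> w' k s ?\<xi>) (K y) w"
          by simp
        from has_gradient_value[OF k has_gradient_cont_value_policy[OF k s policy_differentiable[OF k s]
              cont_value_differentiable[OF k s policy_w_design[OF k s]] this]]
        show ?thesis
          using elim(2) cont k by (simp add: A_cont \<phi>_def)
      qed
    qed
    moreover have "integrable (?law k) (\<lambda>y. K y + ?A k y)"
      using K(1) A_marginal(1) by simp
    moreover have "(LINT y|?law k. K y + ?A k y) = (\<Sum>l\<in>{k..<horizon M}. LINT y|?law (horizon M). ?A l y)"
      using K A_marginal k G_int by (simp add: sum.atLeast_Suc_lessThan add.commute)
    ultimately show ?case
      by blast
  qed
  then obtain G where G: "integrable (?law 0) G"
    and G_grad: "AE y in ?law 0. has_gradient blk (\<lambda>w'. value_w M \<mu> w' 0 (init M)) (G y) w"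
    and G_int: "(LINT y|?law 0. G y) = (\<Sum>l<horizon M. LINT y|?law (horizon M). ?A l y)"
    by (auto simp: lessThan_atLeast0)
  interpret L: prob_space "?law 0"
    using P.obs_law_prob_sets[of 0] by simp
  \<comment> \<open>Under the probability measure \<open>?law 0\<close> the almost sure statement
    holds at some point \<open>y\<close>. The value at stage 0 does not involve observations, so by
    uniqueness \<open>G\<close> is almost surely the constant \<open>G y\<close>, which equals its
    integral.\<close>
  obtain y where y: "has_gradient blk (\<lambda>w'. value_w M \<mu> w' 0 (init M)) (G y) w"
    using L.ae_filter_bot eventually_happens'[OF _ G_grad] by blast
  have "AE y' in ?law 0. G y' = G y"
    using G_grad by eventually_elim (rule has_gradient_unique[OF _ y])
  then have "(LINT y'|?law 0. G y') = (LINT y'|?law 0. G y)"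
    by (intro integral_cong_AE borel_measurable_integrable[OF G] borel_measurable_const)
  then have "G y = (\<Sum>l<horizon M. LINT y|?law (horizon M). ?A l y)"
    using G_int L.prob_space by simp
  \<comment> \<open>The identity is needed at every \<open>w'\<close>, since both sides are
    differentiated as functions of the parameter.\<close>
  moreover have "expected_utility M (\<mu> w') (induced_stop M (\<mu> w')) = value_w M \<mu> w' 0 (init M)" for w'
    using utility_wd cont_value_wd by (intro oed_process.expected_utility_eq_stage_value process_w)
  ultimately show ?thesis
    using y by (simp add: \<phi>_def)
qed

end
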